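(* Let $n\ge 1$, $\Theta\subseteq\mathsf{FORM}_n$ and $\psi\in\mathsf{FORM}_n$. Then $\Theta\models_\partial\psi$ if and only if $\Theta\vdash\psi$.
   Context: $\mathsf{FORM}_n$ is the set of formulas of infinite-valued Łukasiewicz propositional logic $\text{Ł}_\infty$ in the variables $X_1,\dots,X_n$, and $\Theta\vdash\psi$ means $\psi$ is derivable from $\Theta$ using the Łukasiewicz axioms and Modus Ponens. Each $\phi\in\mathsf{FORM}_n$ determines a function $\hat\phi\colon[0,1]^n\to[0,1]$: a point $v\in[0,1]^n$ assigns $v_i$ to $X_i$ and $\hat\phi(v)$ is the truth value of $\phi$ computed with $\neg x=1-x$, $x\oplus y=\min(1,x+y)$. Differential valuation (in $\mathbb R^n$): for $0\le t\le n$, a tuple $U=(u_0,u_1,\dots,u_t)$ of vectors in $\mathbb R^n$ with $u_1,\dots,u_t$ pairwise orthogonal unit vectors, such that for all sufficiently large integers $m$ the simplex $T_{U,m}=\mathrm{conv}(u_0,\,u_0+u_1/m,\,u_0+u_1/m+u_2/m^2,\dots,u_0+u_1/m+\cdots+u_t/m^t)$ is contained in $[0,1]^n$. $U$ satisfies a formula $\psi$ if there is $m$ such that $\hat\psi=1$ on all of $T_{U,m}$. Stable consequence: $\Theta\models_\partial\psi$ iff every differential valuation in $\mathbb R^n$ satisfying every $\theta\in\Theta$ also satisfies $\psi$. *)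

theory Defs
  imports "HOL-Analysis.Analysis"
begin

text \<open>The primitive connectives are negation and implication, the ones in which the Lukasiewicz
  axioms are written; \<open>A \<oplus> B\<close> stands for the formula \<open>\<not> A \<rightarrow> B\<close>. Formulas in
  \<open>X\<^sub>1, \<dots>, X\<^sub>n\<close> are formulas over a finite type of variables with \<open>n\<close> elements.\<close>

datatype 'v form = Var 'v | Neg "'v form" | Imp "'v form" "'v form" (infixr "\<^bold>\<rightarrow>" 60)

definition Oplus :: "'v form \<Rightarrow> 'v form \<Rightarrow> 'v form" (infixr "\<^bold>\<oplus>" 65) where
  "A \<^bold>\<oplus> B = (Neg A \<^bold>\<rightarrow> B)"

inductive luk_axiom :: "'v form \<Rightarrow> bool" where
  A1: "luk_axiom (A \<^bold>\<rightarrow> B \<^bold>\<rightarrow> A)"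
| A2: "luk_axiom ((A \<^bold>\<rightarrow> B) \<^bold>\<rightarrow> (B \<^bold>\<rightarrow> C) \<^bold>\<rightarrow> A \<^bold>\<rightarrow> C)"
| A3: "luk_axiom (((A \<^bold>\<rightarrow> B) \<^bold>\<rightarrow> B) \<^bold>\<rightarrow> (B \<^bold>\<rightarrow> A) \<^bold>\<rightarrow> A)"
| A4: "luk_axiom ((Neg A \<^bold>\<rightarrow> Neg B) \<^bold>\<rightarrow> B \<^bold>\<rightarrow> A)"

inductive derives :: "'v form set \<Rightarrow> 'v form \<Rightarrow> bool" (infix "\<turnstile>" 50) for \<Theta> where
  ax: "luk_axiom A \<Longrightarrow> \<Theta> \<turnstile> A"
| hyp: "A \<in> \<Theta> \<Longrightarrow> \<Theta> \<turnstile> A"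
| mp: "\<Theta> \<turnstile> A \<Longrightarrow> \<Theta> \<turnstile> A \<^bold>\<rightarrow> B \<Longrightarrow> \<Theta> \<turnstile> B"

definition mv_neg :: "real \<Rightarrow> real" where
  "mv_neg x = 1 - x"

definition mv_oplus :: "real \<Rightarrow> real \<Rightarrow> real" where
  "mv_oplus x y = min 1 (x + y)"

primrec truth_value :: "'n form \<Rightarrow> real ^ 'n \<Rightarrow> real" where
  "truth_value (Var i) v = v $ i"
| "truth_value (Neg A) v = mv_neg (truth_value A v)"
| "truth_value (A \<^bold>\<rightarrow> B) v = mv_oplus (mv_neg (truth_value A v)) (truth_value B v)"

lemma truth_value_Oplus:
  "truth_value (A \<^bold>\<oplus> B) v = mv_oplus (truth_value A v) (truth_value B v)"
  by (simp add: Oplus_def mv_neg_def)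

definition unit_cube :: "(real ^ 'n) set" where
  "unit_cube = {v. \<forall>i. 0 \<le> v $ i \<and> v $ i \<le> 1}"

text \<open>A tuple \<open>(u\<^sub>0, \<dots>, u\<^sub>t)\<close> is a list of length \<open>t + 1\<close>.\<close>

definition dv_vertex :: "(real ^ 'n) list \<Rightarrow> nat \<Rightarrow> nat \<Rightarrow> real ^ 'n" where
  "dv_vertex U m k = (\<Sum>i\<le>k. (1 / real m ^ i) *\<^sub>R (U ! i))"

definition dv_simplex :: "(real ^ 'n) list \<Rightarrow> nat \<Rightarrow> (real ^ 'n) set" where
  "dv_simplex U m = convex hull (dv_vertex U m ` {..<length U})"

definition differential_valuation :: "(real ^ 'n) list \<Rightarrow> bool" where
  "differential_valuation U \<longleftrightarrow>
     (\<exists>t \<le> CARD('n). length U = t + 1 \<and>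
        (\<forall>i\<in>{1..t}. norm (U ! i) = 1) \<and>
        (\<forall>i\<in>{1..t}. \<forall>j\<in>{1..t}. i \<noteq> j \<longrightarrow> orthogonal (U ! i) (U ! j))) \<and>
     (\<forall>\<^sub>F m in sequentially. dv_simplex U m \<subseteq> unit_cube)"

text \<open>The case \<open>m = 0\<close> is excluded because division by zero would collapse the simplex to
  \<open>{u\<^sub>0}\<close>; the simplex has to lie in the cube, the domain of the function of a formula.\<close>

definition dv_satisfies :: "(real ^ 'n) list \<Rightarrow> 'n form \<Rightarrow> bool" where
  "dv_satisfies U \<psi> \<longleftrightarrow>
     (\<exists>m\<ge>1. dv_simplex U m \<subseteq> unit_cube \<and> (\<forall>v\<in>dv_simplex U m. truth_value \<psi> v = 1))"

definition stable_consequence :: "('n::finite) form set \<Rightarrow> 'n form \<Rightarrow> bool" (infix "\<Turnstile>\<^sub>\<partial>" 50) where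
  "\<Theta> \<Turnstile>\<^sub>\<partial> \<psi> \<longleftrightarrow>
     (\<forall>U. differential_valuation U \<longrightarrow> (\<forall>\<theta>\<in>\<Theta>. dv_satisfies U \<theta>) \<longrightarrow> dv_satisfies U \<psi>)"

end

theory Submission imports Defs "HOL-Library.Poly_Mapping" begin

text \<open>Soundness holds because the simplices of a differential valuation shrink as \<open>m\<close> grows.
  For completeness, extend \<open>\<Theta>\<close> to a theory \<open>T\<close> maximal among those not proving \<open>\<psi>\<close>;
  prelinearity makes its Lindenbaum algebra a chain. The chain is the unit interval of a totally
  ordered abelian group with unit, generated by the variables and the unit, so it induces a total
  group preorder on \<open>\<int>\<^sup>n\<^sup>+\<^sup>1\<close>. Repeated separation of the negative elements from the origin
  turns this preorder into the lexicographic order of finitely many linear functionals. The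
  first one, normalised at the unit, is evaluation at a point \<open>u\<^sub>0\<close> of the cube; the others are
  orthonormal vectors \<open>u\<^sub>1, \<dots>, u\<^sub>t\<close>. An integral affine function that is nonnegative in the
  preorder is nonnegative on the simplices of \<open>(u\<^sub>0, \<dots>, u\<^sub>t)\<close> for large \<open>m\<close>, and one vanishing
  on such a simplex is null in the preorder; so this differential valuation satisfies exactly
  the formulas that \<open>T\<close> proves.\<close>

section \<open>Truncated difference\<close>

text \<open>The axioms are those of an MV-algebra read in terms of truncated difference, up to the
  congruence \<open>x \<doteq> y\<close>; \<open>null x\<close> stands for \<open>x \<doteq> 0\<close>.\<close>

locale bounded_commutative_bck =
  fixes tdiff :: "'a \<Rightarrow> 'a \<Rightarrow> 'a" (infixl "\<ominus>" 65)
    and null :: "'a \<Rightarrow> bool" and one :: 'a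
  assumes null_tdiff_tdiff: "null ((x \<ominus> y) \<ominus> x)"
    and null_tdiff_antimono: "null (((z \<ominus> x) \<ominus> (z \<ominus> y)) \<ominus> (y \<ominus> x))"
    and null_inf_commute: "null ((x \<ominus> (x \<ominus> y)) \<ominus> (y \<ominus> (y \<ominus> x)))"
    and null_mp: "null x \<Longrightarrow> null (y \<ominus> x) \<Longrightarrow> null y"
    and null_tdiff_one: "null (x \<ominus> one)"
begin

definition le (infix "\<preceq>" 50) where "x \<preceq> y \<longleftrightarrow> null (x \<ominus> y)"
definition eqv (infix "\<doteq>" 50) where "x \<doteq> y \<longleftrightarrow> x \<preceq> y \<and> y \<preceq> x"

lemma null_mono: "x \<preceq> y \<Longrightarrow> null y \<Longrightarrow> null x"
  unfolding le_def by (rule null_mp)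

lemma le_one: "x \<preceq> one"
  by (simp add: le_def null_tdiff_one)

lemma tdiff_le: "x \<ominus> y \<preceq> x"
  by (simp add: le_def null_tdiff_tdiff)

lemma tdiff_mono_right: "y \<preceq> x \<Longrightarrow> z \<ominus> x \<preceq> z \<ominus> y"
  using null_tdiff_antimono null_mp unfolding le_def by blast

lemma le_trans [trans]: "x \<preceq> y \<Longrightarrow> y \<preceq> z \<Longrightarrow> x \<preceq> z"
  using null_tdiff_antimono null_mp unfolding le_def by blast

lemma inf_le: "x \<ominus> (x \<ominus> y) \<preceq> y"
  using le_trans[OF _ tdiff_le] null_inf_commute unfolding le_def by blast

lemma tdiff_exchange_le: "(x \<ominus> y) \<ominus> z \<preceq> (x \<ominus> z) \<ominus> y"
proof -
  have "(x \<ominus> y) \<ominus> z \<preceq> (x \<ominus> y) \<ominus> (x \<ominus> (x \<ominus> z))"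
    by (rule tdiff_mono_right[OF inf_le])
  also have "\<dots> \<preceq> (x \<ominus> z) \<ominus> y"
    by (simp add: le_def null_tdiff_antimono)
  finally show ?thesis .
qed

lemma le_refl: "x \<preceq> x"
  unfolding le_def using null_mono[OF tdiff_exchange_le null_tdiff_tdiff] null_tdiff_tdiff null_mp
  by blast

lemma tdiff_mono_left: "x \<preceq> y \<Longrightarrow> x \<ominus> z \<preceq> y \<ominus> z"
  using tdiff_exchange_le null_tdiff_antimono null_mp null_mono unfolding le_def by blast

lemma tdiff_le_tdiff_one: "x \<ominus> y \<preceq> one \<ominus> y"
  by (rule tdiff_mono_left[OF le_one])

lemma null_imp_le: "null x \<Longrightarrow> x \<preceq> y"
  using null_mono[OF tdiff_le] by (simp add: le_def)

lemma eqv_refl: "x \<doteq> x"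
  by (simp add: eqv_def le_refl)

lemma eqv_sym [sym]: "x \<doteq> y \<Longrightarrow> y \<doteq> x"
  by (simp add: eqv_def)

lemma eqv_trans [trans]: "x \<doteq> y \<Longrightarrow> y \<doteq> z \<Longrightarrow> x \<doteq> z"
  unfolding eqv_def using le_trans by blast

lemma eqv_le_trans [trans]: "x \<doteq> y \<Longrightarrow> y \<preceq> z \<Longrightarrow> x \<preceq> z"
  unfolding eqv_def using le_trans by blast

lemma le_eqv_trans [trans]: "x \<preceq> y \<Longrightarrow> y \<doteq> z \<Longrightarrow> x \<preceq> z"
  unfolding eqv_def using le_trans by blast

lemma le_cong: "x \<doteq> x' \<Longrightarrow> y \<doteq> y' \<Longrightarrow> x \<preceq> y \<longleftrightarrow> x' \<preceq> y'"
  unfolding eqv_def using le_trans by blast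

lemma null_cong: "x \<doteq> y \<Longrightarrow> null x \<longleftrightarrow> null y"
  unfolding eqv_def using null_mono by blast

lemma eqv_tdiff: "x \<doteq> x' \<Longrightarrow> y \<doteq> y' \<Longrightarrow> x \<ominus> y \<doteq> x' \<ominus> y'"
  unfolding eqv_def using tdiff_mono_left tdiff_mono_right le_trans by blast

lemma eqv_tdiff_left: "x \<doteq> x' \<Longrightarrow> x \<ominus> y \<doteq> x' \<ominus> y"
  by (rule eqv_tdiff[OF _ eqv_refl])

lemma eqv_tdiff_right: "y \<doteq> y' \<Longrightarrow> x \<ominus> y \<doteq> x \<ominus> y'"
  by (rule eqv_tdiff[OF eqv_refl])

lemma tdiff_exchange: "(x \<ominus> y) \<ominus> z \<doteq> (x \<ominus> z) \<ominus> y"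
  by (simp add: eqv_def tdiff_exchange_le)

lemma tdiff_le_iff: "x \<ominus> y \<preceq> z \<longleftrightarrow> x \<ominus> z \<preceq> y"
  unfolding le_def by (rule null_cong[OF tdiff_exchange])

lemma inf_commute: "x \<ominus> (x \<ominus> y) \<doteq> y \<ominus> (y \<ominus> x)"
  by (simp add: eqv_def le_def null_inf_commute)

lemma tdiff_null: "null y \<Longrightarrow> x \<ominus> y \<doteq> x"
  unfolding eqv_def using tdiff_le null_mp[of y] inf_le[of x y] le_def by blast

lemma inf_absorb: "x \<preceq> y \<Longrightarrow> y \<ominus> (y \<ominus> x) \<doteq> x"
  using eqv_trans[OF inf_commute tdiff_null] by (simp add: le_def)

lemma one_tdiff_one_tdiff: "one \<ominus> (one \<ominus> x) \<doteq> x"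
  by (rule inf_absorb[OF le_one])

lemma one_le_one_tdiff_iff: "one \<preceq> one \<ominus> x \<longleftrightarrow> null x"
  unfolding le_def by (rule null_cong[OF one_tdiff_one_tdiff])

lemma one_tdiff_tdiff_one_tdiff: "(one \<ominus> y) \<ominus> (one \<ominus> x) \<doteq> x \<ominus> y"
  by (rule eqv_trans[OF tdiff_exchange eqv_tdiff_left[OF one_tdiff_one_tdiff]])

lemma tdiff_one_tdiff_commute: "x \<ominus> (one \<ominus> y) \<doteq> y \<ominus> (one \<ominus> x)"
  using eqv_trans[OF eqv_tdiff_left[OF eqv_sym[OF one_tdiff_one_tdiff]] one_tdiff_tdiff_one_tdiff] .

lemma one_tdiff_le_iff: "one \<ominus> y \<preceq> one \<ominus> x \<longleftrightarrow> x \<preceq> y"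
  using null_cong[OF one_tdiff_tdiff_one_tdiff] by (simp add: le_def)

lemma tdiff_right_le_iff:
  assumes "x \<preceq> z"
  shows "z \<ominus> y \<preceq> z \<ominus> x \<longleftrightarrow> x \<preceq> y"
proof
  assume "z \<ominus> y \<preceq> z \<ominus> x"
  have "x \<doteq> z \<ominus> (z \<ominus> x)" by (rule eqv_sym[OF inf_absorb[OF assms]])
  also have "\<dots> \<preceq> z \<ominus> (z \<ominus> y)" by (rule tdiff_mono_right) fact
  also have "\<dots> \<preceq> y" by (rule inf_le)
  finally show "x \<preceq> y" .
qed (rule tdiff_mono_right)

lemma tdiff_left_le_iff:
  assumes "z \<preceq> y"
  shows "x \<ominus> z \<preceq> y \<ominus> z \<longleftrightarrow> x \<preceq> y"
proof -
  have "x \<ominus> z \<preceq> y \<ominus> z \<longleftrightarrow>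
      (one \<ominus> z) \<ominus> (one \<ominus> x) \<preceq> (one \<ominus> z) \<ominus> (one \<ominus> y)"
    by (intro le_cong eqv_sym[OF one_tdiff_tdiff_one_tdiff])
  also have "\<dots> \<longleftrightarrow> x \<preceq> y"
    using assms by (simp add: tdiff_right_le_iff one_tdiff_le_iff)
  finally show ?thesis .
qed

lemma tdiff_sup_right: "(x \<ominus> y) \<ominus> (z \<ominus> y) \<doteq> (x \<ominus> z) \<ominus> (y \<ominus> z)"
proof -
  let ?n = "\<lambda>x. one \<ominus> x"
  have "(x \<ominus> y) \<ominus> (z \<ominus> y) \<doteq> (?n y \<ominus> ?n x) \<ominus> (?n y \<ominus> ?n z)"
    by (intro eqv_tdiff eqv_sym[OF one_tdiff_tdiff_one_tdiff])
  also have "\<dots> \<doteq> (?n y \<ominus> (?n y \<ominus> ?n z)) \<ominus> ?n x"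
    by (rule tdiff_exchange)
  also have "\<dots> \<doteq> (?n z \<ominus> (?n z \<ominus> ?n y)) \<ominus> ?n x"
    by (rule eqv_tdiff_left[OF inf_commute])
  also have "\<dots> \<doteq> (?n z \<ominus> ?n x) \<ominus> (?n z \<ominus> ?n y)"
    by (rule tdiff_exchange)
  also have "\<dots> \<doteq> (x \<ominus> z) \<ominus> (y \<ominus> z)"
    by (intro eqv_tdiff one_tdiff_tdiff_one_tdiff)
  finally show ?thesis .
qed

lemma prelinearity: "null ((x \<ominus> y) \<ominus> ((x \<ominus> y) \<ominus> (y \<ominus> x)))"
proof -
  define z where "z = x \<ominus> (y \<ominus> x)"
  have "(x \<ominus> y) \<ominus> ((x \<ominus> y) \<ominus> (y \<ominus> x)) \<doteq> (x \<ominus> y) \<ominus> (z \<ominus> y)"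
    unfolding z_def by (rule eqv_tdiff_right[OF tdiff_exchange])
  also have "\<dots> \<doteq> (x \<ominus> z) \<ominus> (y \<ominus> z)"
    by (rule tdiff_sup_right)
  also have "\<dots> \<preceq> (y \<ominus> x) \<ominus> (y \<ominus> z)"
    unfolding z_def by (rule tdiff_mono_left[OF inf_le])
  also have "\<dots> \<doteq> (y \<ominus> (y \<ominus> z)) \<ominus> x"
    by (rule tdiff_exchange)
  also have "\<dots> \<preceq> z \<ominus> x"
    by (rule tdiff_mono_left[OF inf_le])
  finally show ?thesis
    by (rule null_mono) (simp add: z_def null_tdiff_tdiff)
qed

lemma tdiff_tdiff_commute:
  assumes "x \<preceq> z" "y \<preceq> z"
  shows "x \<ominus> (z \<ominus> y) \<doteq> y \<ominus> (z \<ominus> x)"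
proof -
  have "x \<ominus> (z \<ominus> y) \<doteq> (z \<ominus> (z \<ominus> x)) \<ominus> (z \<ominus> y)"
    by (rule eqv_tdiff_left[OF eqv_sym[OF inf_absorb[OF assms(1)]]])
  also have "\<dots> \<doteq> (z \<ominus> (z \<ominus> y)) \<ominus> (z \<ominus> x)"
    by (rule tdiff_exchange)
  also have "\<dots> \<doteq> y \<ominus> (z \<ominus> x)"
    by (rule eqv_tdiff_left[OF inf_absorb[OF assms(2)]])
  finally show ?thesis .
qed

lemma tdiff_tdiff_cancel_right:
  assumes "z \<preceq> y" "y \<preceq> x"
  shows "(x \<ominus> z) \<ominus> (y \<ominus> z) \<doteq> x \<ominus> y"
proof -
  have "z \<preceq> x" using assms by (rule le_trans)
  have "y \<ominus> z \<doteq> (x \<ominus> (x \<ominus> y)) \<ominus> (x \<ominus> (x \<ominus> z))"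
    by (intro eqv_tdiff eqv_sym[OF inf_absorb] assms \<open>z \<preceq> x\<close>)
  also have "\<dots> \<doteq> (x \<ominus> (x \<ominus> (x \<ominus> z))) \<ominus> (x \<ominus> y)"
    by (rule tdiff_exchange)
  also have "\<dots> \<doteq> (x \<ominus> z) \<ominus> (x \<ominus> y)"
    by (rule eqv_tdiff_left[OF inf_absorb[OF tdiff_le]])
  finally have "(x \<ominus> z) \<ominus> (y \<ominus> z) \<doteq> (x \<ominus> z) \<ominus> ((x \<ominus> z) \<ominus> (x \<ominus> y))"
    by (rule eqv_tdiff_right)
  also have "\<dots> \<doteq> x \<ominus> y"
    by (rule inf_absorb[OF tdiff_mono_right[OF assms(1)]])
  finally show ?thesis .
qed

text \<open>The next three lemmas make the additions of \<open>y\<close> and \<open>z\<close> to the element \<open>1 - x\<close> commute when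
  carries occur.\<close>

lemma one_tdiff_tdiff_commute:
  assumes "x \<preceq> y" "x \<preceq> z"
  shows "(one \<ominus> (y \<ominus> x)) \<ominus> z \<doteq> (one \<ominus> (z \<ominus> x)) \<ominus> y"
proof -
  let ?n = "\<lambda>x. one \<ominus> x"
  have "?n (y \<ominus> x) \<ominus> z \<doteq> ?n z \<ominus> (y \<ominus> x)"
    by (rule tdiff_exchange)
  also have "\<dots> \<doteq> ?n z \<ominus> (?n x \<ominus> ?n y)"
    by (rule eqv_tdiff_right[OF eqv_sym[OF one_tdiff_tdiff_one_tdiff]])
  also have "\<dots> \<doteq> ?n y \<ominus> (?n x \<ominus> ?n z)"
    using assms by (intro tdiff_tdiff_commute) (simp_all add: one_tdiff_le_iff)
  also have "\<dots> \<doteq> ?n y \<ominus> (z \<ominus> x)"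
    by (rule eqv_tdiff_right[OF one_tdiff_tdiff_one_tdiff])
  also have "\<dots> \<doteq> ?n (z \<ominus> x) \<ominus> y"
    by (rule tdiff_exchange)
  finally show ?thesis .
qed

lemma tdiff_one_tdiff_tdiff_commute:
  "z \<ominus> (one \<ominus> (y \<ominus> x)) \<doteq> y \<ominus> (one \<ominus> (z \<ominus> x))"
proof -
  have "z \<ominus> (one \<ominus> (y \<ominus> x)) \<doteq> (y \<ominus> x) \<ominus> (one \<ominus> z)"
    by (rule tdiff_one_tdiff_commute)
  also have "\<dots> \<doteq> (y \<ominus> (one \<ominus> z)) \<ominus> x" by (rule tdiff_exchange)
  also have "\<dots> \<doteq> (z \<ominus> (one \<ominus> y)) \<ominus> x"
    by (rule eqv_tdiff_left[OF tdiff_one_tdiff_commute])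
  also have "\<dots> \<doteq> (z \<ominus> x) \<ominus> (one \<ominus> y)" by (rule tdiff_exchange)
  also have "\<dots> \<doteq> y \<ominus> (one \<ominus> (z \<ominus> x))" by (rule tdiff_one_tdiff_commute)
  finally show ?thesis .
qed

lemma one_tdiff_tdiff_tdiff:
  assumes "z \<preceq> x" "x \<preceq> y"
  shows "(one \<ominus> (y \<ominus> x)) \<ominus> z \<doteq> one \<ominus> (y \<ominus> (x \<ominus> z))"
proof -
  let ?t = "y \<ominus> (x \<ominus> z)"
  have "z \<preceq> ?t"
    using eqv_le_trans[OF eqv_sym[OF inf_absorb[OF assms(1)]] tdiff_mono_left[OF assms(2)]] .
  have "y \<ominus> x \<doteq> (y \<ominus> z) \<ominus> (x \<ominus> z)"
    by (rule eqv_sym[OF tdiff_tdiff_cancel_right[OF assms]])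
  also have "\<dots> \<doteq> ?t \<ominus> z" by (rule tdiff_exchange)
  finally have yx: "y \<ominus> x \<doteq> ?t \<ominus> z" .
  have "(one \<ominus> (y \<ominus> x)) \<ominus> z \<doteq> (one \<ominus> z) \<ominus> (y \<ominus> x)" by (rule tdiff_exchange)
  also have "\<dots> \<doteq> (one \<ominus> z) \<ominus> (?t \<ominus> z)" by (rule eqv_tdiff_right[OF yx])
  also have "\<dots> \<doteq> one \<ominus> ?t" by (rule tdiff_tdiff_cancel_right[OF \<open>z \<preceq> ?t\<close> le_one])
  finally show ?thesis .
qed

end

section \<open>The ordered group of a chain\<close>

locale total_cone =
  fixes L P :: "'g::ab_group_add set"
  assumes zero_mem: "0 \<in> L" and diff_mem: "x \<in> L \<Longrightarrow> y \<in> L \<Longrightarrow> x - y \<in> L"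
    and cone_add: "x \<in> P \<Longrightarrow> y \<in> P \<Longrightarrow> x + y \<in> P"
    and cone_total: "x \<in> L \<Longrightarrow> x \<in> P \<or> - x \<in> P"
begin

lemma minus_mem: "x \<in> L \<Longrightarrow> - x \<in> L"
  using diff_mem[OF zero_mem] by simp

lemma add_mem: "x \<in> L \<Longrightarrow> y \<in> L \<Longrightarrow> x + y \<in> L"
  using diff_mem[of x "- y"] minus_mem[of y] by simp

lemma sum_mem: "finite S \<Longrightarrow> (\<And>v. v \<in> S \<Longrightarrow> f v \<in> L) \<Longrightarrow> sum f S \<in> L"
  by (induction rule: finite_induct) (simp_all add: zero_mem add_mem)

lemma cone_zero: "0 \<in> P"
  using cone_total[OF zero_mem] by simp

lemma negative_add:
  assumes "x \<in> L - P" "y \<in> L - P"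
  shows "x + y \<in> L - P"
proof -
  have "- y \<in> P" using assms cone_total by blast
  then have "x + y \<notin> P" using cone_add[of "x + y" "- y"] assms by auto
  then show ?thesis using assms add_mem by simp
qed

lemma negative_sum:
  assumes "finite S" "S \<noteq> {}" "\<And>v. v \<in> S \<Longrightarrow> f v \<in> L - P"
  shows "sum f S \<in> L - P"
  using assms
proof (induction rule: finite_ne_induct)
  case (insert v S)
  then show ?case using negative_add[of "f v" "sum f S"] by simp
qed simp

definition kernel :: "'g set" where
  "kernel = {x \<in> P. - x \<in> P}"

lemma kernel_minus: "x \<in> kernel \<Longrightarrow> - x \<in> kernel"
  by (simp add: kernel_def)

lemma kernel_add: "x \<in> kernel \<Longrightarrow> y \<in> kernel \<Longrightarrow> x + y \<in> kernel"
  using cone_add[of x y] cone_add[of "- x" "- y"] by (simp add: kernel_def)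

lemma kernel_diff: "x \<in> kernel \<Longrightarrow> y \<in> kernel \<Longrightarrow> x - y \<in> kernel"
  using kernel_add[of x "- y"] kernel_minus[of y] by simp

lemma cone_cong:
  assumes "x - y \<in> kernel"
  shows "x \<in> P \<longleftrightarrow> y \<in> P"
  using cone_add[of x "- (x - y)"] cone_add[of y "x - y"] assms by (auto simp: kernel_def)

lemma total_cone_vimage:
  assumes "0 \<in> L'" "\<And>x y. x \<in> L' \<Longrightarrow> y \<in> L' \<Longrightarrow> x - y \<in> L'"
    and "\<And>x. x \<in> L' \<Longrightarrow> f x \<in> L"
    and f_diff: "\<And>x y. x \<in> L' \<Longrightarrow> y \<in> L' \<Longrightarrow> f (x - y) = f x - f y"
  shows "total_cone L' (L' \<inter> f -` P)"
proof
  have f_minus: "f (- x) = - f x" and minus_mem: "- x \<in> L'" if "x \<in> L'" for x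
    using f_diff[OF assms(1) that] f_diff[OF assms(1,1)] assms(2)[OF assms(1) that] by simp_all
  show "x + y \<in> L' \<inter> f -` P" if "x \<in> L' \<inter> f -` P" "y \<in> L' \<inter> f -` P" for x y
    using that assms(2)[of x "- y"] f_diff[of x "- y"] f_minus[of y] minus_mem[of y]
    by (simp add: cone_add)
  show "x \<in> L' \<inter> f -` P \<or> - x \<in> L' \<inter> f -` P" if "x \<in> L'" for x
    using that cone_total[OF assms(3)[OF that]] minus_mem f_minus by auto
qed (use assms in auto)

end

definition frag_sum :: "'a list \<Rightarrow> 'a \<Rightarrow>\<^sub>0 int" where
  "frag_sum xs = (\<Sum>x\<leftarrow>xs. frag_of x)"

lemma frag_sum_append: "frag_sum (xs @ ys) = frag_sum xs + frag_sum ys"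
  by (simp add: frag_sum_def)

lemma lookup_frag_sum: "Poly_Mapping.lookup (frag_sum xs) x = int (count (mset xs) x)"
  by (induction xs) (auto simp: frag_sum_def lookup_add)

lemma frag_sum_eq_iff: "frag_sum xs = frag_sum ys \<longleftrightarrow> mset xs = mset ys"
  by (simp add: poly_mapping_eq_iff fun_eq_iff lookup_frag_sum multiset_eq_iff)

lemma ex_frag_sum_diff:
  obtains xs ys where "f = frag_sum xs - frag_sum ys"
proof -
  have "\<exists>xs ys. f = frag_sum xs - frag_sum ys"
    using subset_UNIV[of "Poly_Mapping.keys f"]
  proof (induction f rule: frag_induction)
    case zero
    then show ?case by (intro exI[of _ "[]"]) simp
  next
    case (one x)
    then show ?case by (intro exI[of _ "[x]"] exI[of _ "[]"]) (simp add: frag_sum_def)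
  next
    case (diff a b)
    then obtain xs ys xs' ys' where "a = frag_sum xs - frag_sum ys" "b = frag_sum xs' - frag_sum ys'"
      by blast
    then have "a - b = frag_sum (xs @ ys') - frag_sum (ys @ xs')"
      by (simp add: frag_sum_append)
    then show ?case by blast
  qed
  then show ?thesis using that by blast
qed

locale preorder_translations =
  fixes le :: "'s \<Rightarrow> 's \<Rightarrow> bool" (infix "\<sqsubseteq>" 50)
    and S :: "'s set" and shift :: "'a \<Rightarrow> 's \<Rightarrow> 's" and origin :: 's
  assumes le_trans: "s \<sqsubseteq> t \<Longrightarrow> t \<sqsubseteq> u \<Longrightarrow> s \<sqsubseteq> u"
    and le_total: "s \<in> S \<Longrightarrow> t \<in> S \<Longrightarrow> s \<sqsubseteq> t \<or> t \<sqsubseteq> s"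
    and origin_mem: "origin \<in> S" and shift_mem: "s \<in> S \<Longrightarrow> shift b s \<in> S"
    and shift_le_shift_iff: "s \<in> S \<Longrightarrow> t \<in> S \<Longrightarrow> shift b s \<sqsubseteq> shift b t \<longleftrightarrow> s \<sqsubseteq> t"
    and shift_commute: "s \<in> S \<Longrightarrow> shift b (shift c s) \<sqsubseteq> shift c (shift b s)"
begin

primrec translate :: "'a list \<Rightarrow> 's" where
  "translate [] = origin"
| "translate (x # xs) = shift x (translate xs)"

lemma translate_mem: "translate xs \<in> S"
  by (induction xs) (simp_all add: origin_mem shift_mem)

lemma translate_le_refl: "translate xs \<sqsubseteq> translate xs"
  using le_total[OF translate_mem translate_mem] by blast

lemma translate_append_le_iff:
  "translate (zs @ xs) \<sqsubseteq> translate (zs @ ys) \<longleftrightarrow> translate xs \<sqsubseteq> translate ys"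
  by (induction zs) (simp_all add: shift_le_shift_iff translate_mem)

lemma translate_rotate_le:
  "translate (xs @ y # zs) \<sqsubseteq> translate (y # xs @ zs) \<and>
    translate (y # xs @ zs) \<sqsubseteq> translate (xs @ y # zs)"
proof (induction xs)
  case Nil
  show ?case using translate_le_refl[of "y # zs"] by simp
next
  case (Cons x xs)
  let ?t = "translate (xs @ zs)"
  have "shift x (translate (xs @ y # zs)) \<sqsubseteq> shift x (shift y ?t)"
    "shift x (shift y ?t) \<sqsubseteq> shift x (translate (xs @ y # zs))"
    using Cons.IH translate_mem[of "y # xs @ zs"] translate_mem[of "xs @ y # zs"]
    by (simp_all add: shift_le_shift_iff)
  moreover have "shift x (shift y ?t) \<sqsubseteq> shift y (shift x ?t)"
    "shift y (shift x ?t) \<sqsubseteq> shift x (shift y ?t)"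
    by (rule shift_commute[OF translate_mem])+
  ultimately show ?case
    unfolding append_Cons translate.simps by (meson le_trans)
qed

lemma translate_perm_le: "mset xs = mset ys \<Longrightarrow> translate xs \<sqsubseteq> translate ys"
proof (induction xs arbitrary: ys)
  case Nil
  then show ?case using translate_le_refl[of "[]"] by simp
next
  case (Cons x xs)
  obtain us vs where ys: "ys = us @ x # vs"
    using Cons.prems by (metis in_set_conv_decomp list.set_intros(1) mset_eq_setD)
  then have "translate xs \<sqsubseteq> translate (us @ vs)"
    using Cons by simp
  then have "translate (x # xs) \<sqsubseteq> translate (x # us @ vs)"
    by (simp add: shift_le_shift_iff translate_mem)
  then show ?case using translate_rotate_le le_trans ys by blast
qed

definition cone :: "('a \<Rightarrow>\<^sub>0 int) set" where
  "cone = {frag_sum xs - frag_sum ys | xs ys. translate ys \<sqsubseteq> translate xs}"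

lemma frag_sum_diff_mem_cone_iff:
  "frag_sum xs - frag_sum ys \<in> cone \<longleftrightarrow> translate ys \<sqsubseteq> translate xs"
proof
  assume "frag_sum xs - frag_sum ys \<in> cone"
  then obtain xs' ys' where eq: "frag_sum xs - frag_sum ys = frag_sum xs' - frag_sum ys'"
    and translate_le: "translate ys' \<sqsubseteq> translate xs'" by (auto simp: cone_def)
  have "frag_sum (ys @ xs') = frag_sum (ys' @ xs)"
    using eq by (simp add: frag_sum_append algebra_simps)
  then have "translate (ys @ xs') \<sqsubseteq> translate (ys' @ xs)"
    by (simp only: frag_sum_eq_iff translate_perm_le)
  moreover have "translate (ys' @ ys) \<sqsubseteq> translate (ys @ ys')"
    by (rule translate_perm_le) simp
  ultimately have "translate (ys' @ ys) \<sqsubseteq> translate (ys' @ xs)"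
    using translate_le le_trans by (meson translate_append_le_iff)
  then show "translate ys \<sqsubseteq> translate xs"
    by (simp only: translate_append_le_iff)
qed (auto simp: cone_def)

sublocale total_cone UNIV cone
proof
  fix f g :: "'a \<Rightarrow>\<^sub>0 int"
  obtain xs ys where f: "f = frag_sum xs - frag_sum ys" by (rule ex_frag_sum_diff)
  obtain xs' ys' where g: "g = frag_sum xs' - frag_sum ys'" by (rule ex_frag_sum_diff)
  have "- f = frag_sum ys - frag_sum xs" by (simp add: f)
  then show "f \<in> cone \<or> - f \<in> cone"
    unfolding f using le_total[OF translate_mem translate_mem] by (simp add: frag_sum_diff_mem_cone_iff)
  assume "f \<in> cone" "g \<in> cone"
  then have "translate (ys' @ ys) \<sqsubseteq> translate (ys' @ xs)"
    "translate (xs @ ys') \<sqsubseteq> translate (xs @ xs')"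
    unfolding f g frag_sum_diff_mem_cone_iff translate_append_le_iff .
  moreover have "translate (ys' @ xs) \<sqsubseteq> translate (xs @ ys')"
    by (rule translate_perm_le) simp
  ultimately have "translate (ys' @ ys) \<sqsubseteq> translate (xs @ xs')"
    using le_trans by blast
  moreover have "f + g = frag_sum (xs @ xs') - frag_sum (ys' @ ys)"
    by (simp add: f g frag_sum_append)
  ultimately show "f + g \<in> cone"
    by (simp only: frag_sum_diff_mem_cone_iff)
qed simp_all

end

locale bck_chain = bounded_commutative_bck +
  assumes null_total: "null (x \<ominus> y) \<or> null (y \<ominus> x)"
    and not_null_one: "\<not> null one"
begin

lemma le_total: "x \<preceq> y \<or> y \<preceq> x"
  using null_total by (simp add: le_def)

lemma not_le_tdiff: "\<not> null x \<Longrightarrow> x \<preceq> y \<Longrightarrow> \<not> y \<preceq> y \<ominus> x"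
  using null_cong[OF inf_absorb[of x y]] by (simp add: le_def)

text \<open>A pair \<open>(n, x)\<close> with \<open>x\<close> not null stands for the element \<open>n + 1 - x\<close> of the ordered
  group of the chain.\<close>

definition state_le :: "nat \<times> 'a \<Rightarrow> nat \<times> 'a \<Rightarrow> bool" where
  "state_le s t \<longleftrightarrow> fst s < fst t \<or> fst s = fst t \<and> snd t \<preceq> snd s"

fun shift :: "'a \<Rightarrow> nat \<times> 'a \<Rightarrow> nat \<times> 'a" where
  "shift y (n, x) = (if x \<preceq> y then (Suc n, one \<ominus> (y \<ominus> x)) else (n, x \<ominus> y))"

lemma not_null_shift: "\<not> null (snd s) \<Longrightarrow> \<not> null (snd (shift y s))"
proof (cases s)
  case (Pair n x)
  assume "\<not> null (snd s)"
  then have "\<not> null (one \<ominus> (y \<ominus> x))" if "x \<preceq> y"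
    using Pair not_le_tdiff[OF _ that] le_trans[OF le_one] le_def by auto
  then show ?thesis using Pair by (auto simp: le_def)
qed

lemma shift_le_shift_iff:
  assumes "\<not> null (snd s)" "\<not> null (snd t)"
  shows "state_le (shift b s) (shift b t) \<longleftrightarrow> state_le s t"
proof (cases s, cases t)
  fix n x m y
  assume s: "s = (n, x)" and t: "t = (m, y)"
  \<comment> \<open>The fractional part of the sum is less than \<open>b\<close> with carry and at least \<open>b\<close> without.\<close>
  have le_carry: "u \<ominus> b \<preceq> one \<ominus> (b \<ominus> v)" for u v
    using le_trans[OF tdiff_le_tdiff_one tdiff_mono_right[OF tdiff_le]] .
  have not_carry_le: "\<not> one \<ominus> (b \<ominus> y) \<preceq> x \<ominus> b" if "y \<preceq> b"
  proof
    assume "one \<ominus> (b \<ominus> y) \<preceq> x \<ominus> b"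
    also have "\<dots> \<preceq> one \<ominus> b" by (rule tdiff_le_tdiff_one)
    finally show False
      using not_le_tdiff[OF _ that] assms(2) t by (simp add: one_tdiff_le_iff)
  qed
  consider (both_carry) "x \<preceq> b" "y \<preceq> b" | (left_carry) "x \<preceq> b" "\<not> y \<preceq> b"
    | (right_carry) "\<not> x \<preceq> b" "y \<preceq> b" | (neither_carry) "\<not> x \<preceq> b" "\<not> y \<preceq> b"
    by blast
  then show ?thesis
  proof cases
    case both_carry
    then show ?thesis by (simp add: s t state_le_def one_tdiff_le_iff tdiff_right_le_iff)
  next
    case left_carry
    then have "\<not> y \<preceq> x" using le_trans by blast
    then show ?thesis using left_carry le_carry by (auto simp: s t state_le_def)
  next
    case right_carry
    then have "y \<preceq> x" using le_trans le_total by blast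
    then show ?thesis using right_carry not_carry_le by (auto simp: s t state_le_def)
  next
    case neither_carry
    then have "b \<preceq> x" using le_total by blast
    then show ?thesis using neither_carry by (simp add: s t state_le_def tdiff_left_le_iff)
  qed
qed

lemma tdiff_one_carry:
  assumes "x \<preceq> y" "\<not> x \<preceq> z"
  shows "\<not> one \<ominus> (y \<ominus> x) \<preceq> z" "x \<ominus> z \<preceq> y"
    "(one \<ominus> (y \<ominus> x)) \<ominus> z \<doteq> one \<ominus> (y \<ominus> (x \<ominus> z))"
proof -
  have "one \<ominus> z \<preceq> one \<ominus> x" if "one \<ominus> (y \<ominus> x) \<preceq> z"
    using that le_trans[OF _ tdiff_le_tdiff_one] unfolding tdiff_le_iff[of one "y \<ominus> x"] by blast
  then show "\<not> one \<ominus> (y \<ominus> x) \<preceq> z"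
    using assms(2) by (auto simp: one_tdiff_le_iff)
  show "x \<ominus> z \<preceq> y" using le_trans[OF tdiff_le assms(1)] .
  show "(one \<ominus> (y \<ominus> x)) \<ominus> z \<doteq> one \<ominus> (y \<ominus> (x \<ominus> z))"
    using one_tdiff_tdiff_tdiff le_total assms by blast
qed

lemma shift_commute: "state_le (shift b (shift c s)) (shift c (shift b s))"
proof (cases s)
  case (Pair n x)
  consider (neither_carry) "\<not> x \<preceq> b" "\<not> x \<preceq> c" | (both_carry) "x \<preceq> b" "x \<preceq> c"
    | (left_carry) "x \<preceq> b" "\<not> x \<preceq> c" | (right_carry) "\<not> x \<preceq> b" "x \<preceq> c"
    by blast
  then show ?thesis
  proof cases
    case neither_carry
    then have "b \<preceq> x" "c \<preceq> x" using le_total by blast+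
    then have "c \<ominus> (x \<ominus> b) \<doteq> b \<ominus> (x \<ominus> c)" by (intro tdiff_tdiff_commute)
    then show ?thesis
      using neither_carry tdiff_exchange_le tdiff_le_iff[of x b c]
      by (auto simp: Pair state_le_def one_tdiff_le_iff eqv_def)
  next
    case both_carry
    then have swap: "(one \<ominus> (b \<ominus> x)) \<ominus> c \<doteq> (one \<ominus> (c \<ominus> x)) \<ominus> b"
      by (rule one_tdiff_tdiff_commute)
    then have "one \<ominus> (b \<ominus> x) \<preceq> c \<longleftrightarrow> one \<ominus> (c \<ominus> x) \<preceq> b"
      unfolding le_def by (rule null_cong)
    then show ?thesis
      using both_carry swap tdiff_one_tdiff_tdiff_commute[of c b x]
      by (auto simp: Pair state_le_def one_tdiff_le_iff eqv_def)
  next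
    case left_carry
    then show ?thesis
      using tdiff_one_carry[OF left_carry] by (simp add: Pair state_le_def eqv_def)
  next
    case right_carry
    then show ?thesis
      using tdiff_one_carry[OF right_carry(2,1)] by (simp add: Pair state_le_def eqv_def)
  qed
qed

sublocale states: preorder_translations state_le "{s. \<not> null (snd s)}" shift "(0, one)"
proof
  show "state_le s u" if "state_le s t" "state_le t u" for s t u
    using that le_trans[of "snd u" "snd t" "snd s"] by (auto simp: state_le_def)
  show "state_le s t \<or> state_le t s" for s t
    using le_total by (auto simp: state_le_def)
  show "(0, one) \<in> {s. \<not> null (snd s)}"
    by (simp add: not_null_one)
  show "shift b s \<in> {s. \<not> null (snd s)}" if "s \<in> {s. \<not> null (snd s)}" for b s
    using that not_null_shift[of s b] by simp
  show "state_le (shift b s) (shift b t) \<longleftrightarrow> state_le s t"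
    if "s \<in> {s. \<not> null (snd s)}" "t \<in> {s. \<not> null (snd s)}" for b s t
    using that by (simp add: shift_le_shift_iff)
  show "state_le (shift b (shift c s)) (shift c (shift b s))" for b c s
    by (rule shift_commute)
qed

lemma frag_of_mem_cone: "frag_of x \<in> states.cone"
  using states.frag_sum_diff_mem_cone_iff[of "[x]" "[]"]
  by (auto simp: frag_sum_def state_le_def tdiff_le)

lemma minus_frag_of_mem_cone_iff: "- frag_of x \<in> states.cone \<longleftrightarrow> null x"
proof -
  have "one \<preceq> x \<Longrightarrow> \<not> null x" using not_null_one null_mono by blast
  then show ?thesis
    using states.frag_sum_diff_mem_cone_iff[of "[]" "[x]"]
    by (auto simp: frag_sum_def state_le_def one_le_one_tdiff_iff)
qed

lemma frag_of_tdiff_mem_kernel: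
  assumes "x \<preceq> y"
  shows "frag_of (y \<ominus> x) + frag_of x - frag_of y \<in> states.kernel"
proof -
  have "state_le (states.translate [y \<ominus> x, x]) (states.translate [y]) \<and>
      state_le (states.translate [y]) (states.translate [y \<ominus> x, x])"
  proof (cases "one \<preceq> x")
    case True
    then have one_le_y: "one \<preceq> y" using assms le_trans by blast
    have null_diff: "null (y \<ominus> x)" using le_trans[OF le_one True] by (simp add: le_def)
    have x_eqv: "one \<ominus> (x \<ominus> one) \<doteq> one" and y_eqv: "one \<ominus> (y \<ominus> one) \<doteq> one"
      by (simp_all add: tdiff_null null_tdiff_one)
    have "\<not> one \<ominus> (x \<ominus> one) \<preceq> y \<ominus> x"
      using null_diff null_mono null_cong[OF x_eqv] not_null_one by blast
    moreover have "(one \<ominus> (x \<ominus> one)) \<ominus> (y \<ominus> x) \<doteq> one \<ominus> (y \<ominus> one)"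
      using eqv_trans[OF eqv_trans[OF tdiff_null[OF null_diff] x_eqv] eqv_sym[OF y_eqv]] .
    ultimately show ?thesis using True one_le_y by (simp add: state_le_def eqv_def)
  next
    case False
    have diff: "(one \<ominus> x) \<ominus> (y \<ominus> x) \<doteq> one \<ominus> y"
      by (rule tdiff_tdiff_cancel_right[OF assms le_one])
    have iff: "one \<ominus> x \<preceq> y \<ominus> x \<longleftrightarrow> one \<preceq> y"
      unfolding le_def by (rule null_cong[OF diff])
    have "(y \<ominus> x) \<ominus> (one \<ominus> x) \<preceq> z" "y \<ominus> one \<preceq> z" for z
      using tdiff_le_tdiff_one[of y x] null_tdiff_one[of y] unfolding le_def[of "y \<ominus> x"]
      by (simp_all add: null_imp_le)
    then show ?thesis using False diff iff by (auto simp: state_le_def one_tdiff_le_iff eqv_def)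
  qed
  then have "frag_sum [y \<ominus> x, x] - frag_sum [y] \<in> states.kernel"
    by (simp add: states.kernel_def states.frag_sum_diff_mem_cone_iff del: states.translate.simps)
  then show ?thesis
    by (simp add: frag_sum_def)
qed

lemma frag_of_diff_mem_cone_iff: "frag_of y - frag_of x \<in> states.cone \<longleftrightarrow> x \<preceq> y"
proof
  assume "x \<preceq> y"
  then have "frag_of (y \<ominus> x) - (frag_of y - frag_of x) \<in> states.kernel"
    using frag_of_tdiff_mem_kernel[of x y] by (simp add: algebra_simps)
  then show "frag_of y - frag_of x \<in> states.cone"
    using states.cone_cong frag_of_mem_cone by blast
next
  assume cone: "frag_of y - frag_of x \<in> states.cone"
  show "x \<preceq> y"
  proof (rule disjE[OF le_total])
    assume "y \<preceq> x"
    then have "(frag_of y - frag_of x) - (- frag_of (x \<ominus> y)) \<in> states.kernel"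
      using frag_of_tdiff_mem_kernel[of y x] by (simp add: algebra_simps)
    then have "- frag_of (x \<ominus> y) \<in> states.cone"
      using states.cone_cong cone by blast
    then show "x \<preceq> y" by (simp add: minus_frag_of_mem_cone_iff le_def)
  qed
qed

end

section \<open>Derivability and prime theories\<close>

lemma derives_syllogism: "T \<turnstile> A \<^bold>\<rightarrow> B \<Longrightarrow> T \<turnstile> B \<^bold>\<rightarrow> C \<Longrightarrow> T \<turnstile> A \<^bold>\<rightarrow> C"
  using mp[OF _ mp[OF _ ax[OF A2]]] .

lemma derives_contrapos: "T \<turnstile> A \<^bold>\<rightarrow> Neg B \<^bold>\<rightarrow> Neg C \<Longrightarrow> T \<turnstile> A \<^bold>\<rightarrow> C \<^bold>\<rightarrow> B"
  using derives_syllogism[OF _ ax[OF A4]] .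

lemma derives_assertion: "T \<turnstile> A \<^bold>\<rightarrow> (A \<^bold>\<rightarrow> B) \<^bold>\<rightarrow> B"
  using derives_syllogism[OF ax[OF A1] ax[OF A3]] .

lemma derives_identity: "T \<turnstile> A \<^bold>\<rightarrow> A"
proof -
  have "T \<turnstile> ((A \<^bold>\<rightarrow> A \<^bold>\<rightarrow> A) \<^bold>\<rightarrow> A) \<^bold>\<rightarrow> A"
    by (rule mp[OF ax[OF A1] derives_assertion])
  then show ?thesis by (rule derives_syllogism[OF ax[OF A1]])
qed

lemma derives_discharge: "T \<turnstile> B \<Longrightarrow> T \<turnstile> A \<^bold>\<rightarrow> B \<^bold>\<rightarrow> C \<Longrightarrow> T \<turnstile> A \<^bold>\<rightarrow> C"
  by (rule derives_syllogism[OF _ mp[OF _ derives_assertion]])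

definition bot_form :: "'v form" where
  "bot_form = Neg (Var undefined \<^bold>\<rightarrow> Var undefined)"

lemma derives_bot_imp: "T \<turnstile> bot_form \<^bold>\<rightarrow> A"
  unfolding bot_form_def
  by (rule derives_discharge[OF derives_identity derives_contrapos[OF ax[OF A1]]])

lemma derives_Neg_imp: "T \<turnstile> Neg A \<^bold>\<rightarrow> A \<^bold>\<rightarrow> B"
  by (rule derives_contrapos[OF ax[OF A1]])

lemma derives_double_negation: "T \<turnstile> Neg (Neg A) \<^bold>\<rightarrow> A"
  by (rule derives_discharge[OF derives_identity derives_contrapos[OF derives_Neg_imp]])

lemma derives_imp_bot_imp_Neg: "T \<turnstile> (A \<^bold>\<rightarrow> bot_form) \<^bold>\<rightarrow> Neg A"
proof -
  have "T \<turnstile> (A \<^bold>\<rightarrow> bot_form) \<^bold>\<rightarrow> Neg (Neg A) \<^bold>\<rightarrow> bot_form"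
    by (rule mp[OF derives_double_negation ax[OF A2]])
  then show ?thesis
    unfolding bot_form_def by (rule derives_discharge[OF derives_identity derives_contrapos])
qed

lemma derives_mono: "T \<turnstile> A \<Longrightarrow> T \<subseteq> T' \<Longrightarrow> T' \<turnstile> A"
  by (induction rule: derives.induct) (auto intro: derives.intros)

lemma derives_compact:
  assumes "T \<turnstile> A"
  obtains F where "finite F" "F \<subseteq> T" "F \<turnstile> A"
proof -
  have "\<exists>F. finite F \<and> F \<subseteq> T \<and> F \<turnstile> A"
    using assms
  proof induction
    case (ax A)
    then show ?case using derives.ax by blast
  next
    case (hyp A)
    then show ?case using derives.hyp[of A "{A}"] by (intro exI[of _ "{A}"]) simp
  next
    case (mp A B)
    obtain F where F: "finite F" "F \<subseteq> T" "F \<turnstile> A" using mp.IH(1) by blast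
    obtain F' where F': "finite F'" "F' \<subseteq> T" "F' \<turnstile> A \<^bold>\<rightarrow> B" using mp.IH(2) by blast
    have "F \<union> F' \<turnstile> A" by (rule derives_mono[OF F(3)]) simp
    moreover have "F \<union> F' \<turnstile> A \<^bold>\<rightarrow> B" by (rule derives_mono[OF F'(3)]) simp
    ultimately have "F \<union> F' \<turnstile> B" by (rule derives.mp)
    then show ?case using F(1,2) F'(1,2) by (intro exI[of _ "F \<union> F'"]) simp
  qed
  then show ?thesis using that by blast
qed

text \<open>A formula stands for its deficit \<open>1 - \<phi>\<close>: implication reversed is truncated difference,
  and derivability is vanishing.\<close>

interpretation luk: bounded_commutative_bck "\<lambda>A B. B \<^bold>\<rightarrow> A" "derives T" bot_form for T
proof
  show "T \<turnstile> x \<Longrightarrow> T \<turnstile> x \<^bold>\<rightarrow> y \<Longrightarrow> T \<turnstile> y" for x y by (rule mp)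
qed (rule derives_bot_imp ax luk_axiom.intros)+

abbreviation luk_disj :: "'v form \<Rightarrow> 'v form \<Rightarrow> 'v form" where
  "luk_disj A B \<equiv> (A \<^bold>\<rightarrow> B) \<^bold>\<rightarrow> B"

lemma derives_disj_left: "T \<turnstile> A \<Longrightarrow> T \<turnstile> luk_disj A B"
  by (rule mp[OF _ derives_assertion])

lemma derives_disj_commute: "T \<turnstile> luk_disj A B \<Longrightarrow> T \<turnstile> luk_disj B A"
  using mp[OF _ luk.null_inf_commute] .

lemma derives_disj_mp:
  assumes "T \<turnstile> luk_disj A C" "T \<turnstile> luk_disj (A \<^bold>\<rightarrow> B) C"
  shows "T \<turnstile> luk_disj B C"
proof -
  let ?le = "luk.le T"
  have "?le C ((A \<^bold>\<rightarrow> B) \<^bold>\<rightarrow> C)"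
    using assms(2) by (simp add: luk.le_def)
  also have "?le \<dots> ((A \<^bold>\<rightarrow> B) \<^bold>\<rightarrow> A \<^bold>\<rightarrow> C)"
    using assms(1) by (intro luk.tdiff_mono_left) (simp add: luk.le_def)
  also have "?le \<dots> (B \<^bold>\<rightarrow> C)"
    using luk.null_mono[OF luk.tdiff_exchange_le luk.null_tdiff_antimono] by (simp add: luk.le_def)
  finally show ?thesis by (simp add: luk.le_def)
qed

lemma derives_disj_insert:
  assumes "insert A T \<turnstile> B" "T \<turnstile> luk_disj A C"
  shows "T \<turnstile> luk_disj B C"
  using assms(1)
proof induction
  case (ax B)
  then show ?case by (rule derives_disj_left[OF derives.ax])
next
  case (hyp B)
  then show ?case using assms(2) derives_disj_left derives.hyp by blast
next
  case (mp B D)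
  show ?case using mp.IH by (rule derives_disj_mp)
qed

locale prime_theory =
  fixes T :: "'v form set"
  assumes consistent: "\<not> T \<turnstile> bot_form"
    and derives_linear: "T \<turnstile> A \<^bold>\<rightarrow> B \<or> T \<turnstile> B \<^bold>\<rightarrow> A"

sublocale prime_theory \<subseteq> bck_chain "\<lambda>A B. B \<^bold>\<rightarrow> A" "derives T" bot_form
  by unfold_locales (rule derives_linear consistent)+

lemma ex_maximal_nonderiving:
  assumes "\<not> \<Theta> \<turnstile> \<psi>"
  obtains T where "\<Theta> \<subseteq> T" "\<not> T \<turnstile> \<psi>" "\<And>A. T \<turnstile> A \<or> insert A T \<turnstile> \<psi>"
proof -
  define \<A> where "\<A> = {T. \<Theta> \<subseteq> T \<and> \<not> T \<turnstile> \<psi>}"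
  have "\<exists>M\<in>\<A>. \<forall>X\<in>\<A>. M \<subseteq> X \<longrightarrow> X = M"
  proof (rule subset_Zorn_nonempty)
    show "\<A> \<noteq> {}" using assms by (auto simp: \<A>_def)
  next
    fix C assume C: "C \<noteq> {}" "subset.chain \<A> C"
    then have "C \<subseteq> \<A>" by (auto simp: subset_chain_def)
    have "\<not> \<Union>C \<turnstile> \<psi>"
    proof
      assume "\<Union>C \<turnstile> \<psi>"
      then obtain F where F: "finite F" "F \<subseteq> \<Union>C" "F \<turnstile> \<psi>" by (rule derives_compact)
      obtain T where "T \<in> C" "F \<subseteq> T" by (rule finite_subset_Union_chain[OF F(1,2) C])
      then show False using derives_mono[OF F(3)] \<open>C \<subseteq> \<A>\<close> by (auto simp: \<A>_def)
    qed
    then show "\<Union>C \<in> \<A>"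
      using \<open>C \<subseteq> \<A>\<close> C(1) by (auto simp: \<A>_def)
  qed
  then obtain T where T: "T \<in> \<A>" and max: "\<And>X. X \<in> \<A> \<Longrightarrow> T \<subseteq> X \<Longrightarrow> X = T" by blast
  have "T \<turnstile> A \<or> insert A T \<turnstile> \<psi>" for A
    using max[of "insert A T"] T hyp[of A T] unfolding \<A>_def by blast
  then show ?thesis using T by (intro that[of T]) (auto simp: \<A>_def)
qed

lemma ex_prime_extension:
  assumes "\<not> \<Theta> \<turnstile> \<psi>"
  obtains T where "\<Theta> \<subseteq> T" "\<not> T \<turnstile> \<psi>" "prime_theory T"
proof -
  obtain T where T: "\<Theta> \<subseteq> T" "\<not> T \<turnstile> \<psi>" and max: "\<And>A. T \<turnstile> A \<or> insert A T \<turnstile> \<psi>"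
    by (rule ex_maximal_nonderiving[OF assms]) blast
  have "T \<turnstile> A \<^bold>\<rightarrow> B \<or> T \<turnstile> B \<^bold>\<rightarrow> A" for A B
  proof (rule ccontr)
    assume "\<not> ?thesis"
    then have ext: "insert (A \<^bold>\<rightarrow> B) T \<turnstile> \<psi>" "insert (B \<^bold>\<rightarrow> A) T \<turnstile> \<psi>" using max by blast+
    have "T \<turnstile> luk_disj \<psi> (B \<^bold>\<rightarrow> A)"
      by (rule derives_disj_insert[OF ext(1) luk.prelinearity])
    then have "T \<turnstile> luk_disj (B \<^bold>\<rightarrow> A) \<psi>"
      by (rule derives_disj_commute)
    then have "T \<turnstile> luk_disj \<psi> \<psi>"
      by (rule derives_disj_insert[OF ext(2)])
    then show False using mp[OF derives_identity] T(2) by blast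
  qed
  moreover have "\<not> T \<turnstile> bot_form" using T(2) mp[OF _ derives_bot_imp] by blast
  ultimately show ?thesis using that T by (simp add: prime_theory_def)
qed

section \<open>Total cones of discrete groups are lexicographic\<close>

lemma Dirichlet_approx_finite:
  fixes u :: "'b \<Rightarrow> real"
  assumes "finite S" "\<delta> > 0"
  obtains q :: int and p :: "'b \<Rightarrow> int"
  where "q > 0" "\<And>v. v \<in> S \<Longrightarrow> \<bar>of_int q * u v - of_int (p v)\<bar> < \<delta>"
proof -
  obtain N :: nat where N: "N > 0" "1 / real N < \<delta>"
    using real_arch_inverse[of \<delta>] assms(2) by (auto simp: inverse_eq_divide)
  obtain h where h: "bij_betw h S {0..<card S}"
    using ex_bij_betw_finite_nat[OF assms(1)] by blast
  obtain q p where q: "q > 0" and approx: "\<And>i. i < card S \<Longrightarrow>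
      \<bar>of_int q * u (inv_into S h i) - of_int (p i)\<bar> < 1 / real N"
    using Dirichlet_approx_simult[OF N(1), of "card S" "\<lambda>i. u (inv_into S h i)"] by metis
  have "\<bar>of_int q * u v - of_int (p (h v))\<bar> < \<delta>" if "v \<in> S" for v
  proof -
    have "h v < card S" using bij_betw_apply[OF h that] by simp
    then show ?thesis using approx[of "h v"] bij_betw_inv_into_left[OF h that] N(2) by simp
  qed
  then show ?thesis using that[of q "\<lambda>v. p (h v)"] q by blast
qed

lemma Dirichlet_approx_positive:
  fixes u :: "'b \<Rightarrow> real"
  assumes "finite S" "\<delta> > 0" and pos: "\<And>v. v \<in> S \<Longrightarrow> u v > 0"
  obtains q :: int and k :: "'b \<Rightarrow> nat"
  where "\<forall>v\<in>S. k v > 0" "\<forall>v\<in>S. \<bar>of_int q * u v - real (k v)\<bar> < \<delta>"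
proof -
  define \<epsilon> where "\<epsilon> = Min (insert \<delta> (u ` S))"
  have \<epsilon>: "\<epsilon> > 0" "\<epsilon> \<le> \<delta>" "\<And>v. v \<in> S \<Longrightarrow> \<epsilon> \<le> u v"
    using assms by (auto simp: \<epsilon>_def)
  obtain q :: int and p :: "'b \<Rightarrow> int" where q: "q > 0"
    and p: "\<And>v. v \<in> S \<Longrightarrow> \<bar>of_int q * u v - of_int (p v)\<bar> < \<epsilon>"
    using Dirichlet_approx_finite[OF assms(1) \<epsilon>(1)] by blast
  have p_pos: "p v > 0" if "v \<in> S" for v
  proof -
    have "\<epsilon> \<le> u v" using \<epsilon>(3)[OF that] .
    also have "\<dots> \<le> of_int q * u v" using q pos[OF that] by simp
    finally have "of_int (p v) > (0 :: real)" using p[OF that] by linarith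
    then show ?thesis by simp
  qed
  show ?thesis
  proof
    show "\<forall>v\<in>S. nat (p v) > 0" using p_pos by simp
    show "\<forall>v\<in>S. \<bar>of_int q * u v - real (nat (p v))\<bar> < \<delta>"
    proof
      fix v assume "v \<in> S"
      then show "\<bar>of_int q * u v - real (nat (p v))\<bar> < \<delta>"
        using p[of v] p_pos[of v] \<epsilon>(2) by simp
    qed
  qed
qed

locale discrete_total_cone = total_cone L P for L P :: "'a::euclidean_space set" +
  assumes discrete: "uniform_discrete L"
begin

lemma ex_norm_less_imp_zero: "\<exists>e>0. \<forall>x\<in>L. norm x < e \<longrightarrow> x = 0"
proof -
  obtain e where "e > 0" "\<And>x y. x \<in> L \<Longrightarrow> y \<in> L \<Longrightarrow> dist x y < e \<Longrightarrow> x = y"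
    using discrete unfolding uniform_discrete_def by blast
  then show ?thesis using zero_mem by (intro exI[of _ e]) (auto simp flip: dist_0_norm)
qed

lemma scaleR_nat_mem: "x \<in> L \<Longrightarrow> real n *\<^sub>R x \<in> L"
  by (induction n) (simp_all add: zero_mem scaleR_left_distrib add_mem)

lemma cone_scaleR_nat: "x \<in> P \<Longrightarrow> real n *\<^sub>R x \<in> P"
  by (induction n) (simp_all add: cone_zero scaleR_left_distrib cone_add)

lemma negative_scaleR_nat:
  assumes "x \<in> L - P" "n > 0"
  shows "real n *\<^sub>R x \<in> L - P"
  using assms(2)
proof (induction n rule: nat_induct_non_zero)
  case (Suc n)
  then show ?case using negative_add[OF assms(1), of "real n *\<^sub>R x"] by (simp add: scaleR_left_distrib)
qed (use assms(1) in simp)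

text \<open>An integer combination approximating a multiple of the given one closely enough is a short
  element of \<open>L\<close>, hence zero.\<close>

lemma ex_nat_combination_zero:
  assumes "finite S" "S \<subseteq> L" and pos: "\<And>v. v \<in> S \<Longrightarrow> u v > 0"
    and zero: "(\<Sum>v\<in>S. u v *\<^sub>R v) = 0"
  obtains k :: "'a \<Rightarrow> nat" where "\<forall>v\<in>S. k v > 0" "(\<Sum>v\<in>S. real (k v) *\<^sub>R v) = 0"
proof -
  obtain e where e: "e > 0" and short: "\<And>x. x \<in> L \<Longrightarrow> norm x < e \<Longrightarrow> x = 0"
    using ex_norm_less_imp_zero by blast
  define B where "B = 1 + (\<Sum>v\<in>S. norm v)"
  have "(\<Sum>v\<in>S. norm v) \<ge> 0" by (rule sum_nonneg) simp
  then have B: "B > 0" by (simp add: B_def)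
  obtain q :: int and k :: "'a \<Rightarrow> nat" where k: "\<forall>v\<in>S. k v > 0"
    and approx: "\<forall>v\<in>S. \<bar>of_int q * u v - real (k v)\<bar> < e / B"
    by (rule Dirichlet_approx_positive[OF assms(1) divide_pos_pos[OF e B] pos])
  define y where "y = (\<Sum>v\<in>S. real (k v) *\<^sub>R v)"
  have "y = y - of_int q *\<^sub>R (\<Sum>v\<in>S. u v *\<^sub>R v)" using zero by simp
  also have "\<dots> = (\<Sum>v\<in>S. (real (k v) - of_int q * u v) *\<^sub>R v)"
    by (simp add: y_def scaleR_sum_right sum_subtractf scaleR_diff_left)
  also have "norm \<dots> \<le> (\<Sum>v\<in>S. e / B * norm v)"
  proof (intro sum_norm_le)
    fix v assume "v \<in> S"
    then show "norm ((real (k v) - of_int q * u v) *\<^sub>R v) \<le> e / B * norm v"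
      using approx unfolding norm_scaleR by (intro mult_right_mono) auto
  qed
  also have "\<dots> = e / B * (B - 1)"
    by (simp add: B_def sum_distrib_left)
  also have "\<dots> < e" using e B by (simp add: field_simps)
  finally have "norm y < e" .
  moreover have "y \<in> L"
    unfolding y_def using assms(1,2) by (intro sum_mem scaleR_nat_mem) auto
  ultimately show ?thesis using short that[of k] k by (simp add: y_def)
qed

lemma zero_notin_convex_hull_negative: "0 \<notin> convex hull (L - P)"
proof
  assume "0 \<in> convex hull (L - P)"
  then obtain S0 u where S0: "finite S0" "S0 \<subseteq> L - P" "\<forall>x\<in>S0. 0 \<le> u x" "sum u S0 = 1"
      "(\<Sum>v\<in>S0. u v *\<^sub>R v) = 0"
    unfolding convex_hull_explicit by blast
  define S where "S = {v \<in> S0. u v > 0}"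
  have S: "finite S" "S \<subseteq> L - P" and pos: "\<And>v. v \<in> S \<Longrightarrow> u v > 0"
    using S0 by (auto simp: S_def)
  have "sum u S = sum u S0"
    using S0 by (intro sum.mono_neutral_left) (auto simp: S_def)
  then have "S \<noteq> {}" using S0 by auto
  have "(\<Sum>v\<in>S. u v *\<^sub>R v) = (\<Sum>v\<in>S0. u v *\<^sub>R v)"
    using S0 by (intro sum.mono_neutral_left) (auto simp: S_def)
  then have "(\<Sum>v\<in>S. u v *\<^sub>R v) = 0" using S0 by simp
  then obtain k :: "'a \<Rightarrow> nat"
    where k: "\<forall>v\<in>S. k v > 0" "(\<Sum>v\<in>S. real (k v) *\<^sub>R v) = 0"
    using S pos ex_nat_combination_zero[of S u] by blast
  have "(\<Sum>v\<in>S. real (k v) *\<^sub>R v) \<in> L - P"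
    using S k(1) by (intro negative_sum \<open>S \<noteq> {}\<close> negative_scaleR_nat) auto
  then show False using k(2) cone_zero by simp
qed

end

definition leading_functional :: "'a::euclidean_space set \<Rightarrow> 'a set \<Rightarrow> 'a \<Rightarrow> bool" where
  "leading_functional L P w \<longleftrightarrow>
     w \<noteq> 0 \<and> (\<forall>z\<in>L. w \<bullet> z > 0 \<longrightarrow> z \<in> P) \<and> (\<forall>z\<in>L. w \<bullet> z < 0 \<longrightarrow> z \<notin> P)"

lemma leading_functional_scaleR:
  "leading_functional L P w \<Longrightarrow> c > 0 \<Longrightarrow> leading_functional L P (c *\<^sub>R w)"
  by (auto simp: leading_functional_def zero_less_mult_iff mult_less_0_iff)

lemma (in discrete_total_cone) ex_leading_functional:
  assumes "\<not> L \<subseteq> P"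
  obtains w where "w \<in> span L" "leading_functional L P w"
proof -
  have "convex hull (L - P) \<noteq> {}" using assms by auto
  then obtain a where a: "a \<in> span (convex hull (L - P))" "a \<noteq> 0"
      "\<And>x. x \<in> convex hull (L - P) \<Longrightarrow> 0 \<le> a \<bullet> x"
    using separating_hyperplane_set_0_inspan[OF convex_convex_hull _ zero_notin_convex_hull_negative]
    by blast
  have neg: "0 \<le> a \<bullet> x" if "x \<in> L - P" for x
    using a(3) that hull_inc by metis
  have "convex hull (L - P) \<subseteq> span L"
    by (intro hull_minimal) (auto intro: span_base subspace_imp_convex subspace_span)
  then have "- a \<in> span L"
    using a(1) span_mono span_span span_neg by blast
  moreover obtain x where x: "x \<in> L - P" using assms by blast
  have "z \<notin> P" if z: "z \<in> L" "a \<bullet> z > 0" for z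
  proof
    assume "z \<in> P"
    have "x - real n *\<^sub>R z \<in> L - P" for n
    proof -
      have "x - real n *\<^sub>R z \<notin> P"
        using cone_add[OF _ cone_scaleR_nat[OF \<open>z \<in> P\<close>, of n], of "x - real n *\<^sub>R z"] x by auto
      then show ?thesis using x diff_mem scaleR_nat_mem z by auto
    qed
    then have "real n * (a \<bullet> z) \<le> a \<bullet> x" for n
      using neg[of "x - real n *\<^sub>R z"] by (simp add: inner_diff_right)
    moreover obtain n where "real n * (a \<bullet> z) > a \<bullet> x" using reals_Archimedean3[OF z(2)] by blast
    ultimately show False by (meson not_le)
  qed
  then have "leading_functional L P (- a)"
    using neg a(2) by (fastforce simp: leading_functional_def)
  ultimately show ?thesis by (rule that)
qed

primrec lex_cone :: "'a::real_inner list \<Rightarrow> 'a set" where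
  "lex_cone [] = UNIV"
| "lex_cone (w # ws) = {z. w \<bullet> z > 0} \<union> {z \<in> lex_cone ws. w \<bullet> z = 0}"

lemma leading_functional_lex_cone:
  assumes "leading_functional L P w" "z \<in> L"
    and "w \<bullet> z = 0 \<Longrightarrow> z \<in> P \<longleftrightarrow> z \<in> lex_cone ws"
  shows "z \<in> P \<longleftrightarrow> z \<in> lex_cone (w # ws)"
  using assms by (cases "w \<bullet> z" "0 :: real" rule: linorder_cases) (auto simp: leading_functional_def)

lemma dim_orthogonal_slice_less:
  fixes w :: "'a::euclidean_space"
  assumes "w \<in> span L" "w \<noteq> 0"
  shows "dim (L \<inter> {x. w \<bullet> x = 0}) < dim L"
proof (rule dim_psubset)
  have "span (L \<inter> {x. w \<bullet> x = 0}) \<subseteq> {x. w \<bullet> x = 0}"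
    by (intro span_minimal subspace_hyperplane) simp
  then have "w \<notin> span (L \<inter> {x. w \<bullet> x = 0})" using assms(2) by auto
  moreover have "span (L \<inter> {x. w \<bullet> x = 0}) \<subseteq> span L" by (rule span_mono) simp
  ultimately show "span (L \<inter> {x. w \<bullet> x = 0}) \<subset> span L" using assms(1) by blast
qed

lemma (in discrete_total_cone) discrete_total_cone_slice:
  "discrete_total_cone (L \<inter> {x. w \<bullet> x = 0}) (L \<inter> {x. w \<bullet> x = 0} \<inter> id -` P)"
proof (intro discrete_total_cone.intro discrete_total_cone_axioms.intro)
  show "total_cone (L \<inter> {x. w \<bullet> x = 0}) (L \<inter> {x. w \<bullet> x = 0} \<inter> id -` P)"
    by (rule total_cone_vimage) (auto simp: zero_mem diff_mem inner_diff_right)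
  show "uniform_discrete (L \<inter> {x. w \<bullet> x = 0})"
    using discrete by (rule uniform_discrete_subset) simp
qed

lemma ex_lex_cone:
  fixes L P :: "'a::euclidean_space set"
  assumes "discrete_total_cone L P"
  shows "\<exists>ws. set ws \<subseteq> span L \<and> length ws \<le> dim L \<and> (\<forall>w\<in>set ws. norm w = 1) \<and>
    sorted_wrt orthogonal ws \<and> (\<forall>z\<in>L. z \<in> P \<longleftrightarrow> z \<in> lex_cone ws)"
  using assms
proof (induction "dim L" arbitrary: L P rule: less_induct)
  case less
  interpret discrete_total_cone L P by fact
  show ?case
  proof (cases "L \<subseteq> P")
    case True
    then show ?thesis by (intro exI[of _ "[]"]) auto
  next
    case False
    then obtain w0 where w0: "w0 \<in> span L" "leading_functional L P w0"
      by (rule ex_leading_functional)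
    define w where "w = (1 / norm w0) *\<^sub>R w0"
    have "w0 \<noteq> 0" using w0(2) by (simp add: leading_functional_def)
    then have w: "norm w = 1" "w \<in> span L" "leading_functional L P w"
      using w0 by (auto simp: w_def intro: span_scale leading_functional_scaleR)
    define L' where "L' = L \<inter> {x. w \<bullet> x = 0}"
    have dim: "dim L' < dim L"
      unfolding L'_def using w(1,2) by (intro dim_orthogonal_slice_less) auto
    obtain ws where ws: "set ws \<subseteq> span L'" "length ws \<le> dim L'" "\<forall>w\<in>set ws. norm w = 1"
      "sorted_wrt orthogonal ws" "\<forall>z\<in>L'. z \<in> L' \<inter> id -` P \<longleftrightarrow> z \<in> lex_cone ws"
      using less.hyps[OF dim] discrete_total_cone_slice[of w] unfolding L'_def by blast
    have "\<forall>z\<in>L. z \<in> P \<longleftrightarrow> z \<in> lex_cone (w # ws)"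
      using leading_functional_lex_cone[OF w(3)] ws(5) by (auto simp: L'_def)
    moreover have "span L' \<subseteq> {x. w \<bullet> x = 0}"
      unfolding L'_def by (intro span_minimal subspace_hyperplane) simp
    then have "\<forall>v\<in>set ws. orthogonal w v"
      using ws(1) by (auto simp: orthogonal_def)
    moreover have "span L' \<subseteq> span L" unfolding L'_def by (rule span_mono) simp
    ultimately show ?thesis
      using ws w dim by (intro exI[of _ "w # ws"]) auto
  qed
qed

definition int_points :: "'a::euclidean_space set" where
  "int_points = {z. \<forall>b\<in>Basis. z \<bullet> b \<in> \<int>}"

lemma uniform_discrete_int_points: "uniform_discrete int_points"
proof (rule uniformI1[OF zero_less_one])
  fix x y :: 'a
  assume xy: "x \<in> int_points" "y \<in> int_points" "dist x y < 1"
  show "x = y"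
  proof (rule euclidean_eqI)
    fix b :: 'a assume b: "b \<in> Basis"
    have "\<bar>x \<bullet> b - y \<bullet> b\<bar> < 1"
      using Basis_le_norm[OF b, of "x - y"] xy(3) by (simp add: dist_norm inner_diff_left)
    moreover have "x \<bullet> b \<in> \<int>" "y \<bullet> b \<in> \<int>"
      using xy b by (simp_all add: int_points_def)
    ultimately show "x \<bullet> b = y \<bullet> b" by (simp add: Ints_eq_abs_less1)
  qed
qed

lemma diff_mem_int_points: "z \<in> int_points \<Longrightarrow> w \<in> int_points \<Longrightarrow> z - w \<in> int_points"
  by (simp add: int_points_def inner_diff_left)

lemma zero_mem_int_points: "0 \<in> int_points"
  by (simp add: int_points_def)

lemma int_points_Pair_iff: "(z, s) \<in> int_points \<longleftrightarrow> z \<in> int_points \<and> s \<in> \<int>"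
  for z :: "'a::euclidean_space" and s :: real
  by (auto simp: int_points_def Basis_prod_def ball_Un)

lemma int_points_vec_iff: "z \<in> int_points \<longleftrightarrow> (\<forall>i. z $ i \<in> \<int>)"
  for z :: "real ^ 'n"
  by (auto simp: int_points_def Basis_vec_def inner_axis)

lemma axis_mem_int_points: "(axis i 1, 0) \<in> (int_points :: ((real ^ 'n) \<times> real) set)"
  and unit_minus_axis_mem_int_points: "(- axis i 1, 1) \<in> (int_points :: ((real ^ 'n) \<times> real) set)"
  and unit_mem_int_points: "(0, 1) \<in> (int_points :: ((real ^ 'n) \<times> real) set)"
  and minus_unit_mem_int_points: "(0, -1) \<in> (int_points :: ((real ^ 'n) \<times> real) set)"
  by (simp_all add: int_points_Pair_iff int_points_vec_iff axis_def)

text \<open>The affine function \<open>x \<mapsto> z \<bullet> x + s\<close> is the pair \<open>(z, s)\<close>, with value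
  \<open>(z, s) \<bullet> (x, 1)\<close> at \<open>x\<close>; its slope along \<open>u\<close> is \<open>(z, s) \<bullet> (u, 0)\<close>.\<close>

primrec homogenize :: "'a::euclidean_space list \<Rightarrow> ('a \<times> real) list" where
  "homogenize [] = []"
| "homogenize (u # us) = (u, 1) # map (\<lambda>v. (v, 0)) us"

lemma lex_cone_map_Pair_zero: "(z, s) \<in> lex_cone (map (\<lambda>v. (v, 0)) us) \<longleftrightarrow> z \<in> lex_cone us"
  by (induction us) auto

lemma discrete_total_cone_graph:
  fixes P :: "('a::euclidean_space \<times> real) set" and u :: 'a
  assumes "total_cone int_points P"
  defines "f \<equiv> \<lambda>z. (z, - (u \<bullet> z))"
  shows "discrete_total_cone (f -` int_points) (f -` int_points \<inter> f -` P)"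
proof (intro discrete_total_cone.intro discrete_total_cone_axioms.intro)
  have f_diff: "f (x - y) = f x - f y" and f_zero: "f 0 = 0" for x y
    by (simp_all add: f_def inner_diff_right zero_prod_def)
  show "total_cone (f -` int_points) (f -` int_points \<inter> f -` P)"
    by (rule total_cone.total_cone_vimage[OF assms(1)])
      (simp_all add: f_diff f_zero diff_mem_int_points zero_mem_int_points)
  show "uniform_discrete (f -` int_points)"
    using uniform_discrete_int_points
    by (rule uniform_discrete_subset) (auto simp: f_def int_points_Pair_iff)
qed

lemma ex_lex_cone_homogenize:
  fixes P :: "('a::euclidean_space \<times> real) set"
  assumes "total_cone int_points P" "leading_functional int_points P (a, c)" "c > 0"
  obtains u us where "length us \<le> DIM('a)" "\<forall>v\<in>set us. norm v = 1" "sorted_wrt orthogonal us"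
    "\<And>z. z \<in> int_points \<Longrightarrow> z \<in> P \<longleftrightarrow> z \<in> lex_cone (homogenize (u # us))"
proof -
  define u where "u = (1 / c) *\<^sub>R a"
  have "leading_functional int_points P ((1 / c) *\<^sub>R (a, c))"
    using assms(2,3) by (intro leading_functional_scaleR) auto
  then have lead: "leading_functional int_points P (u, 1)"
    using assms(3) by (simp add: u_def)
  define f where "f = (\<lambda>z. (z, - (u \<bullet> z)))"
  define L where "L = f -` int_points"
  have "discrete_total_cone L (L \<inter> f -` P)"
    unfolding L_def f_def by (rule discrete_total_cone_graph[OF assms(1)])
  then obtain us where us: "length us \<le> dim L" "\<forall>v\<in>set us. norm v = 1" "sorted_wrt orthogonal us"
    "\<forall>z\<in>L. z \<in> L \<inter> f -` P \<longleftrightarrow> z \<in> lex_cone us"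
    using ex_lex_cone by blast
  have lex: "z \<in> P \<longleftrightarrow> z \<in> lex_cone (homogenize (u # us))" if z: "z \<in> int_points" for z
    unfolding homogenize.simps
  proof (rule leading_functional_lex_cone[OF lead z])
    assume "(u, 1) \<bullet> z = 0"
    moreover obtain y s where ys: "z = (y, s)" by fastforce
    ultimately have "s = - (u \<bullet> y)" by (simp add: eq_neg_iff_add_eq_0 add.commute)
    then have fy: "f y = z" by (simp add: ys f_def)
    then have "y \<in> L" using z by (simp add: L_def)
    then have "z \<in> P \<longleftrightarrow> y \<in> lex_cone us" using us(4) fy by auto
    also have "\<dots> \<longleftrightarrow> z \<in> lex_cone (map (\<lambda>v. (v, 0)) us)"
      by (simp only: ys lex_cone_map_Pair_zero)
    finally show "z \<in> P \<longleftrightarrow> z \<in> lex_cone (map (\<lambda>v. (v, 0)) us)" .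
  qed
  have "length us \<le> DIM('a)" using us(1) dim_subset_UNIV[of L] by simp
  then show ?thesis by (rule that[OF _ us(2,3) lex])
qed

section \<open>Differential valuations\<close>

lemma truth_value_bounds:
  assumes "v \<in> unit_cube"
  shows "0 \<le> truth_value A v" "truth_value A v \<le> 1"
  using assms by (induction A) (auto simp: unit_cube_def mv_neg_def mv_oplus_def)

lemma truth_value_luk_axiom:
  assumes "luk_axiom A" "v \<in> unit_cube"
  shows "truth_value A v = 1"
proof -
  note bounds = truth_value_bounds[OF assms(2)]
  show ?thesis
    using assms(1)
  proof cases
    case (A1 B C)
    then show ?thesis
      using bounds[of B] bounds[of C] by (simp add: mv_neg_def mv_oplus_def min_def)
  next
    case (A2 B C D)
    then show ?thesis
      using bounds[of B] bounds[of C] bounds[of D] by (simp add: mv_neg_def mv_oplus_def min_def)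
  next
    case (A3 B C)
    then show ?thesis
      using bounds[of B] bounds[of C] by (simp add: mv_neg_def mv_oplus_def min_def)
  next
    case (A4 B C)
    then show ?thesis by (simp add: mv_neg_def mv_oplus_def min_def)
  qed
qed

lemma dv_vertex_mem_dv_simplex: "k < length U \<Longrightarrow> dv_vertex U m k \<in> dv_simplex U m"
  unfolding dv_simplex_def by (intro hull_inc) auto

lemma dv_vertex_rescale:
  fixes m m' :: nat
  assumes "1 \<le> m"
  defines "r \<equiv> real m / real m'"
  shows "dv_vertex U m' k =
    (\<Sum>i<k. (r ^ i - r ^ Suc i) *\<^sub>R dv_vertex U m i) + r ^ k *\<^sub>R dv_vertex U m k"
proof (induction k)
  case 0
  show ?case by (simp add: dv_vertex_def)
next
  case (Suc k)
  have "dv_vertex U m' (Suc k) = dv_vertex U m' k + (1 / real m' ^ Suc k) *\<^sub>R (U ! Suc k)"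
    by (simp add: dv_vertex_def)
  also have "1 / real m' ^ Suc k = r ^ Suc k * (1 / real m ^ Suc k)"
    using assms(1) by (simp add: r_def power_divide)
  also have "(r ^ Suc k * (1 / real m ^ Suc k)) *\<^sub>R (U ! Suc k) =
      r ^ Suc k *\<^sub>R (dv_vertex U m (Suc k) - dv_vertex U m k)"
    by (simp add: dv_vertex_def)
  finally show ?case
    unfolding Suc.IH by (simp add: algebra_simps)
qed

lemma dv_simplex_antimono:
  assumes "1 \<le> m" "m \<le> m'"
  shows "dv_simplex U m' \<subseteq> dv_simplex U m"
  unfolding dv_simplex_def[of U m']
proof (intro hull_minimal)
  define r where "r = real m / real m'"
  have r: "0 \<le> r" "r \<le> 1" using assms by (auto simp: r_def)
  show "dv_vertex U m' ` {..<length U} \<subseteq> dv_simplex U m"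
  proof safe
    fix k assume k: "k < length U"
    define a where "a i = (if i < k then r ^ i - r ^ Suc i else r ^ k)" for i
    have atMost: "{..k} = insert k {..<k}" by auto
    have "(\<Sum>i\<le>k. a i *\<^sub>R dv_vertex U m i) \<in> dv_simplex U m"
    proof (intro convex_sum)
      show "convex (dv_simplex U m)" by (simp add: dv_simplex_def)
      have "(\<Sum>i<k. r ^ i - r ^ Suc i) = 1 - r ^ k"
        using sum_lessThan_telescope'[of "\<lambda>i. r ^ i" k] by simp
      then show "sum a {..k} = 1" by (simp add: atMost a_def)
      show "0 \<le> a i" for i
        using r power_decreasing[of i "Suc i" r] by (auto simp: a_def)
    qed (use k in \<open>auto intro: dv_vertex_mem_dv_simplex\<close>)
    also have "(\<Sum>i\<le>k. a i *\<^sub>R dv_vertex U m i) = dv_vertex U m' k"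
      unfolding dv_vertex_rescale[OF assms(1), of U m' k] r_def[symmetric] atMost
      by (simp add: a_def)
    finally show "dv_vertex U m' k \<in> dv_simplex U m" .
  qed
qed (simp add: dv_simplex_def)

lemma dv_satisfies_iff_eventually:
  assumes "differential_valuation U"
  shows "dv_satisfies U \<phi> \<longleftrightarrow>
    (\<forall>\<^sub>F m in sequentially. \<forall>v\<in>dv_simplex U m. truth_value \<phi> v = 1)"
proof
  assume "dv_satisfies U \<phi>"
  then obtain m where m: "1 \<le> m" "\<forall>v\<in>dv_simplex U m. truth_value \<phi> v = 1"
    by (auto simp: dv_satisfies_def)
  show "\<forall>\<^sub>F m in sequentially. \<forall>v\<in>dv_simplex U m. truth_value \<phi> v = 1"
    using eventually_ge_at_top[of m]
    by eventually_elim (use m dv_simplex_antimono in blast)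
next
  assume "\<forall>\<^sub>F m in sequentially. \<forall>v\<in>dv_simplex U m. truth_value \<phi> v = 1"
  moreover have "\<forall>\<^sub>F m in sequentially. dv_simplex U m \<subseteq> unit_cube"
    using assms by (simp add: differential_valuation_def)
  ultimately have "\<forall>\<^sub>F m in sequentially. m \<ge> 1 \<and> dv_simplex U m \<subseteq> unit_cube \<and>
      (\<forall>v\<in>dv_simplex U m. truth_value \<phi> v = 1)"
    using eventually_ge_at_top[of 1] by eventually_elim simp
  then show "dv_satisfies U \<phi>"
    unfolding dv_satisfies_def using eventually_happens'[OF sequentially_bot] by blast
qed

lemma derives_imp_dv_satisfies:
  assumes "\<Theta> \<turnstile> \<psi>" and U: "differential_valuation U" and "\<And>\<theta>. \<theta> \<in> \<Theta> \<Longrightarrow> dv_satisfies U \<theta>"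
  shows "dv_satisfies U \<psi>"
  using assms(1)
proof induction
  case (ax A)
  have "\<forall>\<^sub>F m in sequentially. dv_simplex U m \<subseteq> unit_cube"
    using U by (simp add: differential_valuation_def)
  then show ?case
    unfolding dv_satisfies_iff_eventually[OF U]
    by eventually_elim (use truth_value_luk_axiom[OF ax] in blast)
next
  case (hyp A)
  then show ?case by (rule assms(3))
next
  case (mp A B)
  have "\<forall>\<^sub>F m in sequentially. dv_simplex U m \<subseteq> unit_cube"
    using U by (simp add: differential_valuation_def)
  with mp.IH show ?case
    unfolding dv_satisfies_iff_eventually[OF U]
  proof eventually_elim
    case (elim m)
    show ?case
    proof
      fix v assume v: "v \<in> dv_simplex U m"
      then have "truth_value B v \<le> 1" using elim(3) by (intro truth_value_bounds) auto
      moreover have "truth_value A v = 1" "truth_value (A \<^bold>\<rightarrow> B) v = 1"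
        using elim(1,2) v by blast+
      then have "truth_value B v \<ge> 1" by (simp add: mv_neg_def mv_oplus_def)
      ultimately show "truth_value B v = 1" by simp
    qed
  qed
qed

lemma tendsto_polynomial_inverse:
  fixes c :: "nat \<Rightarrow> real"
  shows "(\<lambda>m. \<Sum>i\<le>k. (1 / real m) ^ i * c i) \<longlonglongrightarrow> c 0"
proof -
  have "(\<lambda>m. \<Sum>i\<le>k. (1 / real m) ^ i * c i) \<longlonglongrightarrow> (\<Sum>i\<le>k. 0 ^ i * c i)"
    by (intro tendsto_intros lim_1_over_n)
  also have "(\<Sum>i\<le>k. 0 ^ i * c i) = (\<Sum>i\<le>k. if i = 0 then c 0 else 0)"
    by (intro sum.cong) (auto simp: power_0_left)
  also have "\<dots> = c 0" by simp
  finally show ?thesis .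
qed

lemma eventually_lex_cone_nonneg:
  "z \<in> lex_cone ws \<Longrightarrow> k < length ws \<Longrightarrow>
    \<forall>\<^sub>F m in sequentially. 0 \<le> (\<Sum>i\<le>k. (1 / real m) ^ i * (ws ! i \<bullet> z))"
proof (induction ws arbitrary: k)
  case (Cons w ws)
  show ?case
  proof (cases "w \<bullet> z > 0")
    case True
    then have "\<forall>\<^sub>F m in sequentially. 0 < (\<Sum>i\<le>k. (1 / real m) ^ i * ((w # ws) ! i \<bullet> z))"
      by (intro order_tendstoD(1)[OF tendsto_polynomial_inverse]) simp
    then show ?thesis by eventually_elim simp
  next
    case False
    then have w: "w \<bullet> z = 0" "z \<in> lex_cone ws" using Cons.prems(1) by auto
    show ?thesis
    proof (cases k)
      case 0
      then show ?thesis by (simp add: w)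
    next
      case (Suc j)
      have shift: "(\<Sum>i\<le>Suc j. (1 / real m) ^ i * ((w # ws) ! i \<bullet> z)) =
          1 / real m * (\<Sum>i\<le>j. (1 / real m) ^ i * (ws ! i \<bullet> z))" for m
        unfolding sum.atMost_Suc_shift by (simp add: w sum_distrib_left mult.assoc)
      have "\<forall>\<^sub>F m in sequentially. 0 \<le> (\<Sum>i\<le>j. (1 / real m) ^ i * (ws ! i \<bullet> z))"
        using Cons.prems(2) Suc by (intro Cons.IH w(2)) simp
      then show ?thesis
        unfolding Suc shift by eventually_elim simp
    qed
  qed
qed simp

lemma nth_homogenize:
  "i < length U \<Longrightarrow> homogenize U ! i = (U ! i, if i = 0 then 1 else 0)"
  by (cases U; cases i) simp_all

lemma length_homogenize: "length (homogenize U) = length U"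
  by (cases U) simp_all

lemma affine_dv_vertex:
  assumes "k < length U"
  shows "z \<bullet> (dv_vertex U m k, 1) = (\<Sum>i\<le>k. (1 / real m) ^ i * (homogenize U ! i \<bullet> z))"
proof -
  have "(dv_vertex U m k, 1) = (\<Sum>i\<le>k. (1 / real m) ^ i *\<^sub>R homogenize U ! i)"
  proof (rule prod_eqI)
    show "fst (dv_vertex U m k, 1) = fst (\<Sum>i\<le>k. (1 / real m) ^ i *\<^sub>R homogenize U ! i)"
      using assms by (simp add: fst_sum dv_vertex_def nth_homogenize power_one_over)
    have "snd (\<Sum>i\<le>k. (1 / real m) ^ i *\<^sub>R homogenize U ! i) =
        (\<Sum>i\<le>k. if i = 0 then 1 else 0)"
      unfolding snd_sum using assms by (intro sum.cong) (auto simp: nth_homogenize)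
    then show "snd (dv_vertex U m k, 1) = snd (\<Sum>i\<le>k. (1 / real m) ^ i *\<^sub>R homogenize U ! i)"
      by simp
  qed
  then show ?thesis by (simp add: inner_sum_right inner_commute)
qed

lemma eventually_affine_nonneg:
  assumes "z \<in> lex_cone (homogenize U)"
  shows "\<forall>\<^sub>F m in sequentially. \<forall>x\<in>dv_simplex U m. 0 \<le> z \<bullet> (x, 1)"
proof -
  obtain a s where z: "z = (a, s)" by fastforce
  have "\<forall>\<^sub>F m in sequentially. 0 \<le> z \<bullet> (dv_vertex U m k, 1)" if "k < length U" for k
    using eventually_lex_cone_nonneg[OF assms, of k] that
    by (simp only: affine_dv_vertex length_homogenize)
  then have "\<forall>\<^sub>F m in sequentially. \<forall>k\<in>{..<length U}. 0 \<le> z \<bullet> (dv_vertex U m k, 1)"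
    by (intro eventually_ball_finite) auto
  then show ?thesis
  proof eventually_elim
    case (elim m)
    have "dv_simplex U m \<subseteq> {x. a \<bullet> x \<ge> - s}"
      unfolding dv_simplex_def
    proof (intro hull_minimal)
      show "dv_vertex U m ` {..<length U} \<subseteq> {x. a \<bullet> x \<ge> - s}"
      proof safe
        fix k assume "k < length U"
        then have "0 \<le> a \<bullet> dv_vertex U m k + s" using elim by (simp add: z)
        then show "- s \<le> a \<bullet> dv_vertex U m k" by simp
      qed
    qed (rule convex_halfspace_ge)
    then show ?case by (fastforce simp: z)
  qed
qed

lemma lex_cone_orthogonal: "(\<And>w. w \<in> set ws \<Longrightarrow> w \<bullet> z = 0) \<Longrightarrow> z \<in> lex_cone ws"
  by (induction ws) auto

lemma affine_zero_imp_lex_cone: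
  assumes "m \<ge> 1" and zero: "\<And>x. x \<in> dv_simplex U m \<Longrightarrow> z \<bullet> (x, 1) = 0"
  shows "z \<in> lex_cone (homogenize U)"
proof (rule lex_cone_orthogonal)
  fix w assume "w \<in> set (homogenize U)"
  then obtain k where k: "k < length U" and w: "w = homogenize U ! k"
    by (auto simp: in_set_conv_nth length_homogenize)
  have sum: "(\<Sum>i\<le>j. (1 / real m) ^ i * (homogenize U ! i \<bullet> z)) = 0" if "j < length U" for j
    using zero[OF dv_vertex_mem_dv_simplex[OF that]] affine_dv_vertex[OF that] by metis
  have "(1 / real m) ^ k * (homogenize U ! k \<bullet> z) = 0"
  proof (cases k)
    case 0
    then show ?thesis using sum[of 0] k by simp
  next
    case (Suc j)
    then show ?thesis using sum[of "Suc j"] sum[of j] k by simp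
  qed
  then show "w \<bullet> z = 0" using assms(1) by (simp add: w)
qed

lemma differential_valuation_Cons:
  fixes u :: "real ^ 'n"
  assumes "length us \<le> CARD('n)" "\<forall>v\<in>set us. norm v = 1" "sorted_wrt orthogonal us"
    and "\<forall>\<^sub>F m in sequentially. dv_simplex (u # us) m \<subseteq> unit_cube"
  shows "differential_valuation (u # us)"
proof -
  have less: "orthogonal (us ! i) (us ! j)" if "i < j" "j < length us" for i j
    using assms(3) that by (simp add: sorted_wrt_iff_nth_less)
  have "orthogonal ((u # us) ! i) ((u # us) ! j)"
    if "i \<in> {1..length us}" "j \<in> {1..length us}" "i \<noteq> j" for i j
    using that less[of "i - 1" "j - 1"] less[of "j - 1" "i - 1"]
    by (cases i j rule: linorder_cases) (auto simp: nth_Cons' orthogonal_commute)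
  then show ?thesis
    using assms unfolding differential_valuation_def
    by (intro conjI exI[of _ "length us"]) (auto simp: nth_Cons')
qed

lemma eventually_dv_simplex_subset_unit_cube:
  fixes U :: "(real ^ 'n) list"
  assumes "\<And>i. (axis i 1, 0) \<in> lex_cone (homogenize U)"
    and "\<And>i. (- axis i 1, 1) \<in> lex_cone (homogenize U)"
  shows "\<forall>\<^sub>F m in sequentially. dv_simplex U m \<subseteq> unit_cube"
proof -
  have "\<forall>\<^sub>F m in sequentially. \<forall>i. \<forall>x\<in>dv_simplex U m. 0 \<le> x $ i \<and> x $ i \<le> 1"
  proof (rule eventually_all_finite)
    fix i
    show "\<forall>\<^sub>F m in sequentially. \<forall>x\<in>dv_simplex U m. 0 \<le> x $ i \<and> x $ i \<le> 1"
      using eventually_affine_nonneg[OF assms(1)[of i]] eventually_affine_nonneg[OF assms(2)[of i]]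
      by eventually_elim (auto simp: inner_axis')
  qed
  then show ?thesis
    by eventually_elim (auto simp: unit_cube_def)
qed

lemma leading_functional_unit_pos:
  fixes a :: "real ^ 'n" and c :: real
  assumes "leading_functional int_points P (a, c)"
    and "\<And>i. (axis i 1, 0) \<in> P" "\<And>i. (- axis i 1, 1) \<in> P"
  shows "c > 0"
proof -
  have a: "0 \<le> a $ i \<and> a $ i \<le> c" for i
  proof -
    have "\<not> (a, c) \<bullet> (axis i 1, 0) < 0" "\<not> (a, c) \<bullet> (- axis i 1, 1) < 0"
      using assms axis_mem_int_points unit_minus_axis_mem_int_points
      unfolding leading_functional_def by blast+
    then show ?thesis by (simp add: inner_axis)
  qed
  have "c \<noteq> 0"
  proof
    assume "c = 0"
    then have "a = 0" using a by (simp add: vec_eq_iff antisym)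
    then show False
      using \<open>c = 0\<close> assms(1) by (simp add: leading_functional_def zero_prod_def)
  qed
  then show ?thesis using a[of undefined] by linarith
qed

lemma ex_differential_valuation_lex_cone:
  fixes P :: "((real ^ 'n) \<times> real) set"
  assumes "total_cone int_points P"
    and "\<And>i. (axis i 1, 0) \<in> P" "\<And>i. (- axis i 1, 1) \<in> P" and "(0, -1) \<notin> P"
  obtains U where "differential_valuation U"
    "\<And>z. z \<in> int_points \<Longrightarrow> z \<in> P \<longleftrightarrow> z \<in> lex_cone (homogenize U)"
proof -
  interpret discrete_total_cone int_points P
    by (simp add: discrete_total_cone_def discrete_total_cone_axioms_def assms(1)
        uniform_discrete_int_points)
  have "\<not> int_points \<subseteq> P" using assms(4) minus_unit_mem_int_points by blast
  then obtain w where "leading_functional int_points P w"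
    by (rule ex_leading_functional)
  moreover obtain a c where "w = (a, c)" by fastforce
  ultimately have lead: "leading_functional int_points P (a, c)" by simp
  obtain u us where us: "length us \<le> DIM(real ^ 'n)" "\<forall>v\<in>set us. norm v = 1"
      "sorted_wrt orthogonal us"
    and cone: "\<And>z. z \<in> int_points \<Longrightarrow> z \<in> P \<longleftrightarrow> z \<in> lex_cone (homogenize (u # us))"
    by (rule ex_lex_cone_homogenize[OF assms(1) lead leading_functional_unit_pos[OF lead assms(2,3)]])
      blast
  have "(axis i 1, 0) \<in> lex_cone (homogenize (u # us))"
    "(- axis i 1, 1) \<in> lex_cone (homogenize (u # us))" for i
    using assms(2,3) cone axis_mem_int_points unit_minus_axis_mem_int_points by blast+
  then have "\<forall>\<^sub>F m in sequentially. dv_simplex (u # us) m \<subseteq> unit_cube"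
    by (rule eventually_dv_simplex_subset_unit_cube)
  then have "differential_valuation (u # us)"
    using us by (intro differential_valuation_Cons) simp_all
  then show ?thesis using cone by (rule that)
qed

section \<open>The differential valuation of a prime theory\<close>

lemma floor_diff_Ints: "x \<in> \<int> \<Longrightarrow> y \<in> \<int> \<Longrightarrow> \<lfloor>x - y\<rfloor> = \<lfloor>x\<rfloor> - \<lfloor>y\<rfloor>"
  for x y :: real
  by (auto elim!: Ints_cases simp flip: of_int_diff)

text \<open>Formulas stand for their deficits, so \<open>Neg (Var i)\<close> represents the value of the variable
  \<open>i\<close>, and \<open>bot_form\<close> the unit.\<close>

definition frag_of_point :: "(real ^ 'n) \<times> real \<Rightarrow> 'n form \<Rightarrow>\<^sub>0 int" where
  "frag_of_point z =
     (\<Sum>i\<in>UNIV. frag_cmul \<lfloor>fst z $ i\<rfloor> (frag_of (Neg (Var i)))) +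
     frag_cmul \<lfloor>snd z\<rfloor> (frag_of bot_form)"

lemma frag_of_point_diff:
  assumes "z \<in> int_points" "w \<in> int_points"
  shows "frag_of_point (z - w) = frag_of_point z - frag_of_point w"
proof -
  have "\<lfloor>fst (z - w) $ i\<rfloor> = \<lfloor>fst z $ i\<rfloor> - \<lfloor>fst w $ i\<rfloor>" for i
    using assms by (cases z; cases w) (simp add: int_points_Pair_iff int_points_vec_iff floor_diff_Ints)
  moreover have "\<lfloor>snd (z - w)\<rfloor> = \<lfloor>snd z\<rfloor> - \<lfloor>snd w\<rfloor>"
    using assms by (cases z; cases w) (simp add: int_points_Pair_iff floor_diff_Ints)
  ultimately show ?thesis
    by (simp add: frag_of_point_def frag_cmul_diff_distrib sum_subtractf)
qed

lemma frag_of_point_zero: "frag_of_point 0 = 0"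
  by (simp add: frag_of_point_def)

lemma frag_of_point_axis: "frag_of_point (axis i 1, 0) = frag_of (Neg (Var i))"
proof -
  have "(\<Sum>j\<in>UNIV. frag_cmul \<lfloor>axis i 1 $ j :: real\<rfloor> (frag_of (Neg (Var j)))) =
      (\<Sum>j\<in>UNIV. if j = i then frag_of (Neg (Var j)) else 0)"
    by (intro sum.cong) (auto simp: axis_def)
  then show ?thesis by (simp add: frag_of_point_def)
qed

lemma frag_of_point_unit: "frag_of_point (0, 1) = frag_of bot_form"
  by (simp add: frag_of_point_def)

locale finite_prime_theory = prime_theory T for T :: "('n::finite) form set"
begin

definition point_cone :: "((real ^ 'n) \<times> real) set" where
  "point_cone = int_points \<inter> frag_of_point -` states.cone"

lemma total_cone_point_cone: "total_cone int_points point_cone"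
  unfolding point_cone_def
  by (rule states.total_cone_vimage)
    (simp_all add: zero_mem_int_points diff_mem_int_points frag_of_point_diff)

lemma axis_mem_point_cone: "(axis i 1, 0) \<in> point_cone"
  by (simp add: point_cone_def axis_mem_int_points frag_of_point_axis frag_of_mem_cone)

lemma unit_minus_axis_mem_point_cone: "(- axis i 1, 1) \<in> point_cone"
proof -
  have "frag_of_point ((0, 1) - (axis i 1, 0)) = frag_of bot_form - frag_of (Neg (Var i))"
    by (simp only: frag_of_point_diff unit_mem_int_points axis_mem_int_points
        frag_of_point_unit frag_of_point_axis)
  then have "(0, 1) - (axis i 1, 0) \<in> point_cone"
    using le_one by (simp only: point_cone_def Int_iff vimage_eq frag_of_diff_mem_cone_iff
        diff_mem_int_points unit_mem_int_points axis_mem_int_points simp_thms)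
  then show ?thesis by simp
qed

lemma minus_unit_notin_point_cone: "(0, -1) \<notin> point_cone"
proof -
  have "frag_of_point (0 :: real ^ 'n, -1) = - frag_of bot_form"
    using frag_of_point_diff[OF zero_mem_int_points unit_mem_int_points]
    by (simp add: frag_of_point_zero frag_of_point_unit)
  then show ?thesis
    by (simp add: point_cone_def minus_frag_of_mem_cone_iff consistent)
qed

lemma frag_of_Neg_mem_kernel: "frag_of (Neg A) + frag_of A - frag_of bot_form \<in> states.kernel"
proof -
  have "frag_of (Neg A) - frag_of (A \<^bold>\<rightarrow> bot_form) \<in> states.kernel"
    by (simp add: states.kernel_def frag_of_diff_mem_cone_iff le_def derives_Neg_imp
        derives_imp_bot_imp_Neg)
  from states.kernel_add[OF this frag_of_tdiff_mem_kernel[OF le_one, of A]]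
  show ?thesis by (simp add: algebra_simps)
qed

primrec deficit :: "'n form \<Rightarrow> (real ^ 'n) \<times> real" where
  "deficit (Var i) = (0, 1) - (axis i 1, 0)"
| "deficit (Neg A) = (0, 1) - deficit A"
| "deficit (A \<^bold>\<rightarrow> B) = (if T \<turnstile> A \<^bold>\<rightarrow> B then 0 else deficit B - deficit A)"

lemma deficit_mem_int_points: "deficit A \<in> int_points"
  by (induction A)
    (simp_all add: diff_mem_int_points zero_mem_int_points unit_mem_int_points axis_mem_int_points
      del: diff_Pair)

lemma
  shows frag_of_point_deficit_Var:
      "frag_of_point (deficit (Var i)) = frag_of bot_form - frag_of (Neg (Var i))"
    and frag_of_point_deficit_Neg:
      "frag_of_point (deficit (Neg A)) = frag_of bot_form - frag_of_point (deficit A)"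
    and frag_of_point_deficit_Imp: "\<not> T \<turnstile> A \<^bold>\<rightarrow> B \<Longrightarrow>
      frag_of_point (deficit (A \<^bold>\<rightarrow> B)) = frag_of_point (deficit B) - frag_of_point (deficit A)"
  by (simp_all add: frag_of_point_diff unit_mem_int_points axis_mem_int_points
      deficit_mem_int_points frag_of_point_unit frag_of_point_axis del: diff_Pair)

lemma frag_of_deficit_mem_kernel: "frag_of A - frag_of_point (deficit A) \<in> states.kernel"
proof (induction A)
  case (Var i)
  show ?case
    using frag_of_Neg_mem_kernel[of "Var i"] unfolding frag_of_point_deficit_Var
    by (simp add: algebra_simps)
next
  case (Neg A)
  have "frag_of (Neg A) - frag_of_point (deficit (Neg A)) =
      (frag_of (Neg A) + frag_of A - frag_of bot_form) - (frag_of A - frag_of_point (deficit A))"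
    unfolding frag_of_point_deficit_Neg by simp
  also have "\<dots> \<in> states.kernel"
    by (rule states.kernel_diff[OF frag_of_Neg_mem_kernel Neg.IH])
  finally show ?case .
next
  case (Imp A B)
  show ?case
  proof (cases "T \<turnstile> A \<^bold>\<rightarrow> B")
    case True
    then have "frag_of (A \<^bold>\<rightarrow> B) \<in> states.kernel"
      by (simp add: states.kernel_def frag_of_mem_cone minus_frag_of_mem_cone_iff)
    then show ?thesis using True by (simp add: frag_of_point_zero)
  next
    case False
    then have "le A B" using derives_linear by (auto simp: le_def)
    have "frag_of (A \<^bold>\<rightarrow> B) - frag_of_point (deficit (A \<^bold>\<rightarrow> B)) =
        (frag_of (A \<^bold>\<rightarrow> B) + frag_of A - frag_of B) +
        ((frag_of B - frag_of_point (deficit B)) - (frag_of A - frag_of_point (deficit A)))"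
      unfolding frag_of_point_deficit_Imp[OF False] by simp
    also have "\<dots> \<in> states.kernel"
      by (intro states.kernel_add states.kernel_diff frag_of_tdiff_mem_kernel[OF \<open>le A B\<close>] Imp.IH)
    finally show ?thesis .
  qed
qed

lemma deficit_diff_mem_point_cone_iff: "deficit A - deficit B \<in> point_cone \<longleftrightarrow> T \<turnstile> A \<^bold>\<rightarrow> B"
proof -
  have "(frag_of A - frag_of B) - frag_of_point (deficit A - deficit B) =
      (frag_of A - frag_of_point (deficit A)) - (frag_of B - frag_of_point (deficit B))"
    by (simp add: frag_of_point_diff deficit_mem_int_points)
  also have "\<dots> \<in> states.kernel"
    by (intro states.kernel_diff frag_of_deficit_mem_kernel)
  finally have "frag_of A - frag_of B \<in> states.cone \<longleftrightarrow>
      frag_of_point (deficit A - deficit B) \<in> states.cone"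
    by (rule states.cone_cong)
  then show ?thesis
    by (simp add: point_cone_def diff_mem_int_points deficit_mem_int_points
        frag_of_diff_mem_cone_iff le_def)
qed

lemma minus_deficit_mem_point_cone_iff: "- deficit A \<in> point_cone \<longleftrightarrow> T \<turnstile> A"
proof -
  let ?top = "A \<^bold>\<rightarrow> A"
  have "T \<turnstile> ?top" by (rule derives_identity)
  then have "deficit ?top = 0" by simp
  then have "- deficit A \<in> point_cone \<longleftrightarrow> T \<turnstile> ?top \<^bold>\<rightarrow> A"
    using deficit_diff_mem_point_cone_iff[of ?top A] by simp
  also have "\<dots> \<longleftrightarrow> T \<turnstile> A"
    using mp[OF derives_identity] mp[OF _ ax[OF A1]] by blast
  finally show ?thesis .
qed

context
  fixes U :: "(real ^ 'n) list"
  assumes U: "differential_valuation U"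
    and point_cone_iff: "\<And>z. z \<in> int_points \<Longrightarrow> z \<in> point_cone \<longleftrightarrow> z \<in> lex_cone (homogenize U)"
begin

lemma eventually_deficit_le:
  assumes "T \<turnstile> A \<^bold>\<rightarrow> B"
  shows "\<forall>\<^sub>F m in sequentially. \<forall>x\<in>dv_simplex U m. deficit B \<bullet> (x, 1) \<le> deficit A \<bullet> (x, 1)"
proof -
  have "deficit A - deficit B \<in> lex_cone (homogenize U)"
    using assms deficit_diff_mem_point_cone_iff point_cone_iff
      diff_mem_int_points[OF deficit_mem_int_points deficit_mem_int_points] by blast
  from eventually_affine_nonneg[OF this] show ?thesis
    by eventually_elim (simp add: inner_diff_left)
qed

lemma eventually_deficit_eq:
  "\<forall>\<^sub>F m in sequentially. \<forall>x\<in>dv_simplex U m. deficit A \<bullet> (x, 1) = 1 - truth_value A x"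
proof (induction A)
  case (Var i)
  show ?case by (simp add: inner_axis')
next
  case (Neg A)
  then show ?case
    by eventually_elim (simp add: mv_neg_def inner_diff_left)
next
  case (Imp A B)
  show ?case
  proof (cases "T \<turnstile> A \<^bold>\<rightarrow> B")
    case True
    from eventually_deficit_le[OF this] Imp.IH show ?thesis
      by eventually_elim (use True in \<open>auto simp: mv_neg_def mv_oplus_def\<close>)
  next
    case False
    then have "T \<turnstile> B \<^bold>\<rightarrow> A" using derives_linear by blast
    from eventually_deficit_le[OF this] Imp.IH show ?thesis
      by eventually_elim (use False in \<open>auto simp: mv_neg_def mv_oplus_def inner_diff_left\<close>)
  qed
qed

lemma dv_satisfies_iff_derives: "dv_satisfies U A \<longleftrightarrow> T \<turnstile> A"
proof -
  have "dv_satisfies U A \<longleftrightarrow>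
      (\<forall>\<^sub>F m in sequentially. \<forall>x\<in>dv_simplex U m. deficit A \<bullet> (x, 1) = 0)"
    unfolding dv_satisfies_iff_eventually[OF U]
    by (rule eventually_cong[OF eventually_deficit_eq[of A]]) auto
  also have "\<dots> \<longleftrightarrow> T \<turnstile> A"
  proof
    assume "\<forall>\<^sub>F m in sequentially. \<forall>x\<in>dv_simplex U m. deficit A \<bullet> (x, 1) = 0"
    then have "\<forall>\<^sub>F m in sequentially. m \<ge> 1 \<and> (\<forall>x\<in>dv_simplex U m. deficit A \<bullet> (x, 1) = 0)"
      using eventually_ge_at_top by (rule eventually_conj[rotated])
    then obtain m where "m \<ge> 1" "\<forall>x\<in>dv_simplex U m. deficit A \<bullet> (x, 1) = 0"
      using eventually_happens'[OF sequentially_bot] by blast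
    then have "- deficit A \<in> lex_cone (homogenize U)"
      by (intro affine_zero_imp_lex_cone) auto
    then show "T \<turnstile> A"
      using point_cone_iff diff_mem_int_points[OF zero_mem_int_points deficit_mem_int_points]
      by (simp flip: minus_deficit_mem_point_cone_iff)
  next
    assume "T \<turnstile> A"
    then have "T \<turnstile> (A \<^bold>\<rightarrow> A) \<^bold>\<rightarrow> A" using mp[OF _ ax[OF A1]] by blast
    from eventually_deficit_le[OF this] eventually_deficit_le[OF ax[OF A1], of A A]
    show "\<forall>\<^sub>F m in sequentially. \<forall>x\<in>dv_simplex U m. deficit A \<bullet> (x, 1) = 0"
      by eventually_elim (auto simp: derives_identity intro!: antisym)
  qed
  finally show ?thesis .
qed

end

lemma ex_differential_valuation:
  obtains U where "differential_valuation U" "\<And>A. dv_satisfies U A \<longleftrightarrow> T \<turnstile> A"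
proof -
  obtain U where U: "differential_valuation U"
    and "\<And>z. z \<in> int_points \<Longrightarrow> z \<in> point_cone \<longleftrightarrow> z \<in> lex_cone (homogenize U)"
    using ex_differential_valuation_lex_cone[OF total_cone_point_cone axis_mem_point_cone
        unit_minus_axis_mem_point_cone minus_unit_notin_point_cone] by blast
  then show ?thesis using that dv_satisfies_iff_derives by blast
qed

end

theorem theorem3p9:
  fixes \<Theta> :: "('n::finite) form set" and \<psi> :: "'n form"
  shows "\<Theta> \<Turnstile>\<^sub>\<partial> \<psi> \<longleftrightarrow> \<Theta> \<turnstile> \<psi>"
proof
  assume stable: "\<Theta> \<Turnstile>\<^sub>\<partial> \<psi>"
  show "\<Theta> \<turnstile> \<psi>"
  proof (rule ccontr)
    assume "\<not> \<Theta> \<turnstile> \<psi>"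
    then obtain T where T: "\<Theta> \<subseteq> T" "\<not> T \<turnstile> \<psi>" "prime_theory T" by (rule ex_prime_extension)
    then obtain U where U: "differential_valuation U" "\<And>A. dv_satisfies U A \<longleftrightarrow> T \<turnstile> A"
      using finite_prime_theory.ex_differential_valuation finite_prime_theory.intro by blast
    then have "dv_satisfies U \<theta>" if "\<theta> \<in> \<Theta>" for \<theta>
      using that T(1) hyp by blast
    then have "dv_satisfies U \<psi>" using stable U(1) by (simp add: stable_consequence_def)
    then show False using U(2) T(2) by blast
  qed
next
  assume "\<Theta> \<turnstile> \<psi>"
  then show "\<Theta> \<Turnstile>\<^sub>\<partial> \<psi>"
    unfolding stable_consequence_def using derives_imp_dv_satisfies by blast
qed

end
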